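(* Let $\mathcal{H}$ be a Hopf algebra in $\mathrm{SupLat}$ with counit $\epsilon$, and let $\pi:\mathcal{H}\to\mathcal{Q}$ be the coequalizer in $\mathrm{SupLat}$ of the parallel pair $\emptyset,\mathrm{inc}:\epsilon^{-1}(\emptyset)\rightrightarrows\mathcal{H}$, where $\emptyset$ denotes the constant morphism with value the least element of $\mathcal{H}$ and $\mathrm{inc}$ is the inclusion. Then $\mathcal{Q}$ has an induced Hopf algebra structure such that $\pi$ becomes a Hopf algebra morphism, i.e. $\pi$ commutes with all structural morphisms (multiplication, unit, comultiplication, counit, antipode).
   Context: $\mathrm{SupLat}$ is the category whose objects are complete lattices (posets in which every subset $S$ has a join $\vee S$) and whose morphisms are maps preserving arbitrary joins. The least element is denoted $\emptyset$. $\mathcal{L}\otimes\mathcal{M}$ is the complete lattice through which every map $\mathcal{L}\times\mathcal{M}\to\mathcal{K}$ preserving joins separately in each variable factors uniquely as a join-preserving morphism; $(l,m)$ denotes the image of a pair. The unit object is $\mathcal{P}(1)=\{\emptyset,1\}$, and the symmetry is $(l,m)\mapsto(m,l)$. A Hopf algebra in $\mathrm{SupLat}$ is a complete lattice $\mathcal{H}$ with join-preserving morphisms $m:\mathcal{H}\otimes\mathcal{H}\to\mathcal{H}$ (written $a.b$), $\Delta:\mathcal{H}\to\mathcal{H}\otimes\mathcal{H}$, $\epsilon:\mathcal{H}\to\mathcal{P}(1)$, an element $1\in\mathcal{H}$ and an invertible join-preserving morphism $S:\mathcal{H}\to\mathcal{H}$ such that: $m$ is associative with two-sided unit $1$; $(\Delta\otimes\mathrm{id})\Delta=(\mathrm{id}\otimes\Delta)\Delta$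 and $(\epsilon\otimes\mathrm{id})\Delta=\mathrm{id}=(\mathrm{id}\otimes\epsilon)\Delta$; $\Delta(1)=(1,1)$, $\epsilon(1)=1$, $\epsilon(h.h')=1$ iff $\epsilon(h)=\epsilon(h')=1$, and $\Delta(h.h')=\Delta(h).\Delta(h')$ with componentwise product on $\mathcal{H}\otimes\mathcal{H}$; and $m(\mathrm{id}\otimes S)\Delta(h)=m(S\otimes\mathrm{id})\Delta(h)$ equals $1$ if $\epsilon(h)=1$ and equals $\emptyset$ otherwise. The set $\epsilon^{-1}(\emptyset)$ is a complete sublattice of $\mathcal{H}$. With $D=\vee\epsilon^{-1}(\emptyset)$, the lattice $\mathcal{Q}$ is, as a set, the quotient of $\mathcal{H}$ by the relation $h\sim h\vee D$, ordered by $\overline{a}\le\overline{b}$ iff $a\vee D\le b\vee D$, and $\pi(h)=\overline{h}$. *)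

theory Defs
  imports "HOL-Algebra.Complete_Lattice"
begin

section \<open>The category of complete lattices and join-preserving maps\<close>

text \<open>A lattice is given by its carrier and its order. The library's \<^const>\<open>sup_pres\<close>
  already demands that both sides are complete lattices, but not that the function maps
  carrier to carrier.\<close>

definition suplat_hom :: "('a, 'c) gorder_scheme \<Rightarrow> ('b, 'd) gorder_scheme \<Rightarrow> ('a \<Rightarrow> 'b) set" where
  "suplat_hom L M = {f \<in> carrier L \<rightarrow> carrier M. sup_pres L M f}"

definition suplat_bihom ::
    "('a, 'c) gorder_scheme \<Rightarrow> ('b, 'd) gorder_scheme \<Rightarrow> ('k, 'e) gorder_scheme
      \<Rightarrow> ('a \<Rightarrow> 'b \<Rightarrow> 'k) set" where
  "suplat_bihom L M K =
     {f. (\<forall>l\<in>carrier L. f l \<in> suplat_hom M K) \<and>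
         (\<forall>m\<in>carrier M. (\<lambda>l. f l m) \<in> suplat_hom L K)}"

text \<open>The library asks a complete lattice to have all infima as well; they come for free.\<close>

lemma complete_lattice_supI:
  assumes "partial_order L"
    and sup: "\<And>A. A \<subseteq> carrier L \<Longrightarrow> \<exists>s. least L s (Upper L A)"
  shows "complete_lattice L"
proof -
  interpret partial_order L by fact
  show ?thesis
  proof (rule complete_latticeI)
    fix A assume A: "A \<subseteq> carrier L"
    obtain s where s: "least L s (Upper L (Lower L A))"
      using sup[of "Lower L A"] by auto
    then have "s \<in> carrier L" by (auto simp: least_def Upper_def)
    have "x \<sqsubseteq>\<^bsub>L\<^esub> s" if "x \<in> Lower L A" for x
      using s that by (auto simp: least_def Upper_def Lower_def)
    moreover have "s \<sqsubseteq>\<^bsub>L\<^esub> a" if "a \<in> A" for a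
      using s that A by (auto simp: least_def Upper_def Lower_def)
    ultimately have "greatest L s (Lower L A)"
      using A \<open>s \<in> carrier L\<close> by (intro greatest_LowerI) auto
    then show "\<exists>i. greatest L i (Lower L A)" ..
  qed (use sup in auto)
qed

lemma suplat_homD:
  assumes "f \<in> suplat_hom L M"
  shows "complete_lattice L" "complete_lattice M"
    "\<And>x. x \<in> carrier L \<Longrightarrow> f x \<in> carrier M"
    "\<And>A. A \<subseteq> carrier L \<Longrightarrow> f (\<Squnion>\<^bsub>L\<^esub>A) = \<Squnion>\<^bsub>M\<^esub>(f ` A)"
  using assms by (auto simp: suplat_hom_def sup_pres_def)

lemma suplat_homI:
  assumes "complete_lattice L" "complete_lattice M"
    "\<And>x. x \<in> carrier L \<Longrightarrow> f x \<in> carrier M"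
    "\<And>A. A \<subseteq> carrier L \<Longrightarrow> f (\<Squnion>\<^bsub>L\<^esub>A) = \<Squnion>\<^bsub>M\<^esub>(f ` A)"
  shows "f \<in> suplat_hom L M"
  using assms by (auto simp: suplat_hom_def sup_pres_def)

lemma (in complete_lattice) sup_le_iff:
  assumes "A \<subseteq> carrier L" "k \<in> carrier L"
  shows "\<Squnion>A \<sqsubseteq> k \<longleftrightarrow> (\<forall>a\<in>A. a \<sqsubseteq> k)"
proof
  assume *: "\<Squnion>A \<sqsubseteq> k"
  show "\<forall>a\<in>A. a \<sqsubseteq> k"
  proof
    fix a assume "a \<in> A"
    then have "a \<sqsubseteq> \<Squnion>A" using assms sup_upper by blast
    then show "a \<sqsubseteq> k" using * assms \<open>a \<in> A\<close> le_trans[of a "\<Squnion>A" k] by auto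
  qed
qed (use assms sup_least in auto)

lemma (in complete_lattice) eq_by_upper:
  assumes "x \<in> carrier L" "y \<in> carrier L" "\<And>k. k \<in> carrier L \<Longrightarrow> x \<sqsubseteq> k \<longleftrightarrow> y \<sqsubseteq> k"
  shows "x = y"
  using assms(1,2) assms(3)[of x] assms(3)[of y] le_refl by (intro le_antisym) auto


section \<open>Tensor products\<close>

text \<open>The tensor product is realised by the subsets of the product of the carriers that contain
  a pair whose one component is a join if and only if they contain the corresponding pairs for
  all the joinands. (Taking the empty join, and the join of a comparable pair, such sets contain
  all pairs with a least component and are downward closed.) The theorem \<open>tensor_universal\<close> below
  is the universal property.\<close>

definition bi_ideal :: "('a, 'c) gorder_scheme \<Rightarrow> ('b, 'd) gorder_scheme \<Rightarrow> ('a \<times> 'b) set \<Rightarrow> bool"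
  where
  "bi_ideal L M T \<longleftrightarrow>
     T \<subseteq> carrier L \<times> carrier M \<and>
     (\<forall>A \<subseteq> carrier L. \<forall>m \<in> carrier M. (\<Squnion>\<^bsub>L\<^esub>A, m) \<in> T \<longleftrightarrow> (\<forall>a\<in>A. (a, m) \<in> T)) \<and>
     (\<forall>l \<in> carrier L. \<forall>B \<subseteq> carrier M. (l, \<Squnion>\<^bsub>M\<^esub>B) \<in> T \<longleftrightarrow> (\<forall>b\<in>B. (l, b) \<in> T))"

definition tensor :: "('a, 'c) gorder_scheme \<Rightarrow> ('b, 'd) gorder_scheme \<Rightarrow> ('a \<times> 'b) set gorder" where
  "tensor L M = \<lparr>carrier = {T. bi_ideal L M T}, eq = (=), le = (\<subseteq>)\<rparr>"

definition pure_tensor ::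
    "('a, 'c) gorder_scheme \<Rightarrow> ('b, 'd) gorder_scheme \<Rightarrow> 'a \<Rightarrow> 'b \<Rightarrow> ('a \<times> 'b) set" where
  "pure_tensor L M l m = \<Inter>{T \<in> carrier (tensor L M). (l, m) \<in> T}"

definition tensor_lift :: "('k, 'e) gorder_scheme \<Rightarrow> ('a \<Rightarrow> 'b \<Rightarrow> 'k) \<Rightarrow> ('a \<times> 'b) set \<Rightarrow> 'k" where
  "tensor_lift K f T = \<Squnion>\<^bsub>K\<^esub>((\<lambda>(l, m). f l m) ` T)"

lemma tensor_simps [simp]:
  "carrier (tensor L M) = {T. bi_ideal L M T}"
  "(\<sqsubseteq>\<^bsub>tensor L M\<^esub>) = (\<subseteq>)"
  "(.=\<^bsub>tensor L M\<^esub>) = (=)"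
  by (simp_all add: tensor_def)

lemma bi_ideal_Inter:
  assumes "\<And>T. T \<in> \<T> \<Longrightarrow> bi_ideal L M T" "\<T> \<noteq> {}"
  shows "bi_ideal L M (\<Inter>\<T>)"
proof -
  have "\<Inter>\<T> \<subseteq> carrier L \<times> carrier M"
  proof -
    obtain T where T: "T \<in> \<T>" using assms(2) by auto
    then have "\<Inter>\<T> \<subseteq> T" by (rule Inter_lower)
    moreover have "T \<subseteq> carrier L \<times> carrier M" using assms(1)[OF T] by (simp add: bi_ideal_def)
    ultimately show ?thesis by (rule subset_trans)
  qed
  moreover have "(\<Squnion>\<^bsub>L\<^esub>A, m) \<in> \<Inter>\<T> \<longleftrightarrow> (\<forall>a\<in>A. (a, m) \<in> \<Inter>\<T>)"
    if "A \<subseteq> carrier L" "m \<in> carrier M" for A m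
    using assms(1) that by (simp add: bi_ideal_def) blast
  moreover have "(l, \<Squnion>\<^bsub>M\<^esub>B) \<in> \<Inter>\<T> \<longleftrightarrow> (\<forall>b\<in>B. (l, b) \<in> \<Inter>\<T>)"
    if "l \<in> carrier L" "B \<subseteq> carrier M" for l B
    using assms(1) that by (simp add: bi_ideal_def) blast
  ultimately show ?thesis unfolding bi_ideal_def by simp
qed

lemma bi_ideal_top:
  assumes "complete_lattice L" "complete_lattice M"
  shows "bi_ideal L M (carrier L \<times> carrier M)"
proof -
  interpret L: complete_lattice L by fact
  interpret M: complete_lattice M by fact
  show ?thesis unfolding bi_ideal_def by auto
qed

lemma complete_lattice_tensor:
  assumes "complete_lattice L" "complete_lattice M"
  shows "complete_lattice (tensor L M)"
proof -
  interpret partial_order "tensor L M"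
    by standard auto
  show ?thesis
  proof (rule complete_lattice_supI)
    fix A assume A: "A \<subseteq> carrier (tensor L M)"
    let ?U = "Upper (tensor L M) A"
    have top: "carrier L \<times> carrier M \<in> ?U"
      using A bi_ideal_top[OF assms] by (auto simp: Upper_def bi_ideal_def)
    have "bi_ideal L M (\<Inter>?U)"
      by (rule bi_ideal_Inter) (use top in \<open>auto simp: Upper_def\<close>)
    then have "least (tensor L M) (\<Inter>?U) ?U"
      using A by (fastforce simp: least_def Upper_def)
    then show "\<exists>s. least (tensor L M) s ?U" ..
  qed unfold_locales
qed

lemma pure_tensor_closed:
  assumes "complete_lattice L" "complete_lattice M" "l \<in> carrier L" "m \<in> carrier M"
  shows "pure_tensor L M l m \<in> carrier (tensor L M)"
  using bi_ideal_top[OF assms(1,2)] assms(3,4) unfolding pure_tensor_def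
  by (auto intro!: bi_ideal_Inter)

lemma pure_tensor_subset_iff:
  assumes "T \<in> carrier (tensor L M)"
  shows "pure_tensor L M l m \<subseteq> T \<longleftrightarrow> (l, m) \<in> T"
  using assms unfolding pure_tensor_def by blast

lemma pure_tensor_bihom:
  assumes L: "complete_lattice L" and M: "complete_lattice M"
  shows "pure_tensor L M \<in> suplat_bihom L M (tensor L M)"
proof -
  interpret L: complete_lattice L by fact
  interpret M: complete_lattice M by fact
  interpret T: complete_lattice "tensor L M" by (rule complete_lattice_tensor) fact+
  note closed = pure_tensor_closed[OF L M]
  have "pure_tensor L M l (\<Squnion>\<^bsub>M\<^esub>B) = \<Squnion>\<^bsub>tensor L M\<^esub>(pure_tensor L M l ` B)"
    if "l \<in> carrier L" "B \<subseteq> carrier M" for l B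
  proof (rule T.eq_by_upper)
    fix k assume k: "k \<in> carrier (tensor L M)"
    have "pure_tensor L M l ` B \<subseteq> carrier (tensor L M)" using closed that by blast
    then show "(pure_tensor L M l (\<Squnion>\<^bsub>M\<^esub>B) \<sqsubseteq>\<^bsub>tensor L M\<^esub> k) =
        (\<Squnion>\<^bsub>tensor L M\<^esub>(pure_tensor L M l ` B) \<sqsubseteq>\<^bsub>tensor L M\<^esub> k)"
      using that k by (subst T.sup_le_iff)
        (auto simp: pure_tensor_subset_iff bi_ideal_def)
  next
    show "pure_tensor L M l (\<Squnion>\<^bsub>M\<^esub>B) \<in> carrier (tensor L M)"
      by (rule closed) (use that in auto)
    show "\<Squnion>\<^bsub>tensor L M\<^esub>(pure_tensor L M l ` B) \<in> carrier (tensor L M)"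
      by (rule T.sup_closed) (use closed that in blast)
  qed
  moreover have "pure_tensor L M (\<Squnion>\<^bsub>L\<^esub>A) m = \<Squnion>\<^bsub>tensor L M\<^esub>((\<lambda>l. pure_tensor L M l m) ` A)"
    if "m \<in> carrier M" "A \<subseteq> carrier L" for m A
  proof (rule T.eq_by_upper)
    fix k assume k: "k \<in> carrier (tensor L M)"
    have "(\<lambda>l. pure_tensor L M l m) ` A \<subseteq> carrier (tensor L M)" using closed that by blast
    then show "(pure_tensor L M (\<Squnion>\<^bsub>L\<^esub>A) m \<sqsubseteq>\<^bsub>tensor L M\<^esub> k) =
        (\<Squnion>\<^bsub>tensor L M\<^esub>((\<lambda>l. pure_tensor L M l m) ` A) \<sqsubseteq>\<^bsub>tensor L M\<^esub> k)"
      using that k by (subst T.sup_le_iff)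
        (auto simp: pure_tensor_subset_iff bi_ideal_def)
  next
    show "pure_tensor L M (\<Squnion>\<^bsub>L\<^esub>A) m \<in> carrier (tensor L M)"
      by (rule closed) (use that in auto)
    show "\<Squnion>\<^bsub>tensor L M\<^esub>((\<lambda>l. pure_tensor L M l m) ` A) \<in> carrier (tensor L M)"
      by (rule T.sup_closed) (use closed that in blast)
  qed
  ultimately show ?thesis
    unfolding suplat_bihom_def
    using L M T.complete_lattice_axioms
    by (auto intro!: suplat_homI closed simp del: tensor_simps)
qed

theorem tensor_universal:
  assumes L: "complete_lattice L" and M: "complete_lattice M" and K: "complete_lattice K"
    and f: "f \<in> suplat_bihom L M K"
  shows "tensor_lift K f \<in> suplat_hom (tensor L M) K"
    and "\<And>l m. l \<in> carrier L \<Longrightarrow> m \<in> carrier M \<Longrightarrow> tensor_lift K f (pure_tensor L M l m) = f l m"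
    and "\<And>g T. g \<in> suplat_hom (tensor L M) K \<Longrightarrow>
           (\<And>l m. l \<in> carrier L \<Longrightarrow> m \<in> carrier M \<Longrightarrow> g (pure_tensor L M l m) = f l m) \<Longrightarrow>
           T \<in> carrier (tensor L M) \<Longrightarrow> g T = tensor_lift K f T"
proof -
  interpret L: complete_lattice L by fact
  interpret M: complete_lattice M by fact
  interpret K: complete_lattice K by fact
  interpret T: complete_lattice "tensor L M" by (rule complete_lattice_tensor) fact+
  note closed = pure_tensor_closed[OF L M]
  have f1: "f l \<in> suplat_hom M K" if "l \<in> carrier L" for l
    using f that by (simp add: suplat_bihom_def)
  have f2: "(\<lambda>l. f l m) \<in> suplat_hom L K" if "m \<in> carrier M" for m
    using f that by (simp add: suplat_bihom_def)
  have f_closed: "f l m \<in> carrier K" if "l \<in> carrier L" "m \<in> carrier M" for l m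
    using suplat_homD(3)[OF f1[OF that(1)] that(2)] .
  have f_l: "f (\<Squnion>\<^bsub>L\<^esub>A) m = \<Squnion>\<^bsub>K\<^esub>((\<lambda>l. f l m) ` A)" if "A \<subseteq> carrier L" "m \<in> carrier M" for A m
    using suplat_homD(4)[OF f2[OF that(2)] that(1)] .
  have f_m: "f l (\<Squnion>\<^bsub>M\<^esub>B) = \<Squnion>\<^bsub>K\<^esub>(f l ` B)" if "l \<in> carrier L" "B \<subseteq> carrier M" for l B
    using suplat_homD(4)[OF f1[OF that(1)] that(2)] .
  define R where "R k = {(l, m). l \<in> carrier L \<and> m \<in> carrier M \<and> f l m \<sqsubseteq>\<^bsub>K\<^esub> k}" for k
  have R: "R k \<in> carrier (tensor L M)" if k: "k \<in> carrier K" for k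
  proof -
    have "f (\<Squnion>\<^bsub>L\<^esub>A) m \<sqsubseteq>\<^bsub>K\<^esub> k \<longleftrightarrow> (\<forall>a\<in>A. f a m \<sqsubseteq>\<^bsub>K\<^esub> k)" if "A \<subseteq> carrier L" "m \<in> carrier M" for A m
    proof -
      have "(\<lambda>l. f l m) ` A \<subseteq> carrier K" using f_closed that by blast
      then show ?thesis using that k by (simp add: f_l K.sup_le_iff)
    qed
    moreover have "f l (\<Squnion>\<^bsub>M\<^esub>B) \<sqsubseteq>\<^bsub>K\<^esub> k \<longleftrightarrow> (\<forall>b\<in>B. f l b \<sqsubseteq>\<^bsub>K\<^esub> k)"
      if "l \<in> carrier L" "B \<subseteq> carrier M" for l B
    proof -
      have "f l ` B \<subseteq> carrier K" using f_closed that by blast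
      then show ?thesis using that k by (simp add: f_m K.sup_le_iff)
    qed
    ultimately show ?thesis
      unfolding tensor_simps bi_ideal_def R_def by (auto simp: subset_iff)
  qed
  have im: "(\<lambda>(l, m). f l m) ` T \<subseteq> carrier K" if "T \<in> carrier (tensor L M)" for T
    using that f_closed by (auto simp: bi_ideal_def)
  have lift_closed: "tensor_lift K f T \<in> carrier K" if "T \<in> carrier (tensor L M)" for T
    unfolding tensor_lift_def using im[OF that] by (rule K.sup_closed)
  have adj: "tensor_lift K f T \<sqsubseteq>\<^bsub>K\<^esub> k \<longleftrightarrow> T \<subseteq> R k"
    if "T \<in> carrier (tensor L M)" "k \<in> carrier K" for T k
    using im[OF that(1)] that unfolding tensor_lift_def R_def
    by (subst K.sup_le_iff) (auto simp: bi_ideal_def)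
  show "tensor_lift K f \<in> suplat_hom (tensor L M) K"
  proof (rule suplat_homI)
    fix A assume A: "A \<subseteq> carrier (tensor L M)"
    then have sA: "\<Squnion>\<^bsub>tensor L M\<^esub>A \<in> carrier (tensor L M)" by (rule T.sup_closed)
    have iA: "tensor_lift K f ` A \<subseteq> carrier K" using A lift_closed by blast
    show "tensor_lift K f (\<Squnion>\<^bsub>tensor L M\<^esub>A) = \<Squnion>\<^bsub>K\<^esub>(tensor_lift K f ` A)"
    proof (rule K.eq_by_upper)
      fix k assume k: "k \<in> carrier K"
      have "tensor_lift K f (\<Squnion>\<^bsub>tensor L M\<^esub>A) \<sqsubseteq>\<^bsub>K\<^esub> k \<longleftrightarrow> (\<forall>T\<in>A. T \<subseteq> R k)"
        using adj[OF sA k] T.sup_le_iff[OF A R[OF k]] by simp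
      also have "\<dots> \<longleftrightarrow> \<Squnion>\<^bsub>K\<^esub>(tensor_lift K f ` A) \<sqsubseteq>\<^bsub>K\<^esub> k"
      proof -
        have "\<forall>T\<in>A. tensor_lift K f T \<sqsubseteq>\<^bsub>K\<^esub> k \<longleftrightarrow> T \<subseteq> R k"
          using adj[OF _ k] A by auto
        then show ?thesis unfolding K.sup_le_iff[OF iA k] by auto
      qed
      finally show "(tensor_lift K f (\<Squnion>\<^bsub>tensor L M\<^esub>A) \<sqsubseteq>\<^bsub>K\<^esub> k) =
          (\<Squnion>\<^bsub>K\<^esub>(tensor_lift K f ` A) \<sqsubseteq>\<^bsub>K\<^esub> k)" .
    qed (rule lift_closed[OF sA], rule K.sup_closed[OF iA])
  qed (rule T.complete_lattice_axioms K lift_closed, assumption?)+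
  show "tensor_lift K f (pure_tensor L M l m) = f l m" if "l \<in> carrier L" "m \<in> carrier M" for l m
  proof (rule K.eq_by_upper)
    fix k assume k: "k \<in> carrier K"
    show "(tensor_lift K f (pure_tensor L M l m) \<sqsubseteq>\<^bsub>K\<^esub> k) = (f l m \<sqsubseteq>\<^bsub>K\<^esub> k)"
      using adj[OF closed[OF that] k] pure_tensor_subset_iff[OF R[OF k]] that
      by (simp add: R_def)
  qed (rule lift_closed[OF closed[OF that]], rule f_closed[OF that])
  fix g T
  assume g: "g \<in> suplat_hom (tensor L M) K"
    and gp: "\<And>l m. l \<in> carrier L \<Longrightarrow> m \<in> carrier M \<Longrightarrow> g (pure_tensor L M l m) = f l m"
    and T: "T \<in> carrier (tensor L M)"
  let ?P = "(\<lambda>(l, m). pure_tensor L M l m) ` T"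
  have sub: "T \<subseteq> carrier L \<times> carrier M" using T by (simp add: bi_ideal_def)
  have P: "?P \<subseteq> carrier (tensor L M)"
  proof (rule image_subsetI)
    fix x assume "x \<in> T"
    then obtain l m where "x = (l, m)" "l \<in> carrier L" "m \<in> carrier M" using sub by auto
    then show "(case x of (l, m) \<Rightarrow> pure_tensor L M l m) \<in> carrier (tensor L M)"
      using closed by simp
  qed
  have "\<Squnion>\<^bsub>tensor L M\<^esub>?P = T"
  proof (rule T.eq_by_upper)
    fix k assume k: "k \<in> carrier (tensor L M)"
    show "(\<Squnion>\<^bsub>tensor L M\<^esub>?P \<sqsubseteq>\<^bsub>tensor L M\<^esub> k) = (T \<sqsubseteq>\<^bsub>tensor L M\<^esub> k)"
      unfolding T.sup_le_iff[OF P k] using pure_tensor_subset_iff[OF k] by auto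
  qed (rule T.sup_closed[OF P], rule T)
  then have "g T = \<Squnion>\<^bsub>K\<^esub>(g ` ?P)"
    using suplat_homD(4)[OF g P] by simp
  also have "g ` ?P = (\<lambda>(l, m). f l m) ` T"
    unfolding image_image using sub gp by (intro image_cong) auto
  finally show "g T = tensor_lift K f T" by (simp add: tensor_lift_def)
qed

text \<open>The monoidal structure: the action of the tensor product on morphisms (with codomains
  \<open>L'\<close> and \<open>M'\<close>), the associator \<open>(L \<otimes> M) \<otimes> N \<rightarrow> L \<otimes> (M \<otimes> N)\<close>, the unit object \<open>\<P>(1)\<close>
  (with elements \<open>\<emptyset>\<close> = \<^term>\<open>{} :: unit set\<close> and \<open>1\<close> = \<^term>\<open>{()}\<close>), and the two unitors.\<close>

definition tensor_map ::
    "('c, 'x) gorder_scheme \<Rightarrow> ('d, 'y) gorder_scheme \<Rightarrow> ('a \<Rightarrow> 'c) \<Rightarrow> ('b \<Rightarrow> 'd)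
      \<Rightarrow> ('a \<times> 'b) set \<Rightarrow> ('c \<times> 'd) set" where
  "tensor_map L' M' f g =
     tensor_lift (tensor L' M') (\<lambda>l m. pure_tensor L' M' (f l) (g m))"

definition tensor_assoc ::
    "('a, 'x) gorder_scheme \<Rightarrow> ('b, 'y) gorder_scheme \<Rightarrow> ('c, 'z) gorder_scheme
      \<Rightarrow> (('a \<times> 'b) set \<times> 'c) set \<Rightarrow> ('a \<times> ('b \<times> 'c) set) set" where
  "tensor_assoc L M N =
     tensor_lift (tensor L (tensor M N))
       (\<lambda>t n. tensor_lift (tensor L (tensor M N))
         (\<lambda>l m. pure_tensor L (tensor M N) l (pure_tensor M N m n)) t)"

definition P1 :: "unit set gorder" where
  "P1 = \<lparr>carrier = Pow {()}, eq = (=), le = (\<subseteq>)\<rparr>"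

definition left_unitor :: "('a, 'x) gorder_scheme \<Rightarrow> (unit set \<times> 'a) set \<Rightarrow> 'a" where
  "left_unitor L = tensor_lift L (\<lambda>p l. if p = {} then \<bottom>\<^bsub>L\<^esub> else l)"

definition right_unitor :: "('a, 'x) gorder_scheme \<Rightarrow> ('a \<times> unit set) set \<Rightarrow> 'a" where
  "right_unitor L = tensor_lift L (\<lambda>l p. if p = {} then \<bottom>\<^bsub>L\<^esub> else l)"


section \<open>Hopf algebras\<close>

definition alg_prod :: "('a, 'x) gorder_scheme \<Rightarrow> (('a \<times> 'a) set \<Rightarrow> 'a) \<Rightarrow> 'a \<Rightarrow> 'a \<Rightarrow> 'a" where
  "alg_prod H mult a b = mult (pure_tensor H H a b)"

text \<open>The componentwise product \<open>(a, b).(a', b') = (a.a', b.b')\<close>, extended to joins in both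
  arguments.\<close>

definition tensor_alg_prod ::
    "('a, 'x) gorder_scheme \<Rightarrow> (('a \<times> 'a) set \<Rightarrow> 'a)
      \<Rightarrow> ('a \<times> 'a) set \<Rightarrow> ('a \<times> 'a) set \<Rightarrow> ('a \<times> 'a) set" where
  "tensor_alg_prod H mult s t =
     tensor_lift (tensor H H) (\<lambda>a b.
       tensor_lift (tensor H H) (\<lambda>a' b'.
         pure_tensor H H (alg_prod H mult a a') (alg_prod H mult b b')) t) s"

locale suplat_hopf = complete_lattice H
  for H :: "('a, 'x) gorder_scheme" (structure) +
  fixes mult :: "('a \<times> 'a) set \<Rightarrow> 'a"
    and one :: "'a"
    and comult :: "'a \<Rightarrow> ('a \<times> 'a) set"
    and counit :: "'a \<Rightarrow> unit set"
    and antipode :: "'a \<Rightarrow> 'a"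
  assumes mult_hom: "mult \<in> suplat_hom (tensor H H) H"
    and one_closed: "one \<in> carrier H"
    and comult_hom: "comult \<in> suplat_hom H (tensor H H)"
    and counit_hom: "counit \<in> suplat_hom H P1"
    and antipode_hom: "antipode \<in> suplat_hom H H"
    and antipode_invertible:
      "\<exists>S' \<in> suplat_hom H H. \<forall>h \<in> carrier H. S' (antipode h) = h \<and> antipode (S' h) = h"
    and mult_assoc:
      "\<lbrakk>a \<in> carrier H; b \<in> carrier H; c \<in> carrier H\<rbrakk> \<Longrightarrow>
         alg_prod H mult (alg_prod H mult a b) c = alg_prod H mult a (alg_prod H mult b c)"
    and mult_one_left: "a \<in> carrier H \<Longrightarrow> alg_prod H mult one a = a"
    and mult_one_right: "a \<in> carrier H \<Longrightarrow> alg_prod H mult a one = a"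
    and comult_coassoc:
      "h \<in> carrier H \<Longrightarrow>
         tensor_assoc H H H (tensor_map (tensor H H) H comult id (comult h)) =
         tensor_map H (tensor H H) id comult (comult h)"
    and counit_left:
      "h \<in> carrier H \<Longrightarrow> left_unitor H (tensor_map P1 H counit id (comult h)) = h"
    and counit_right:
      "h \<in> carrier H \<Longrightarrow> right_unitor H (tensor_map H P1 id counit (comult h)) = h"
    and comult_one: "comult one = pure_tensor H H one one"
    and counit_one: "counit one = {()}"
    and counit_mult:
      "\<lbrakk>h \<in> carrier H; h' \<in> carrier H\<rbrakk> \<Longrightarrow>
         counit (alg_prod H mult h h') = {()} \<longleftrightarrow> counit h = {()} \<and> counit h' = {()}"
    and comult_mult:
      "\<lbrakk>h \<in> carrier H; h' \<in> carrier H\<rbrakk> \<Longrightarrow>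
         comult (alg_prod H mult h h') = tensor_alg_prod H mult (comult h) (comult h')"
    and antipode_right:
      "h \<in> carrier H \<Longrightarrow>
         mult (tensor_map H H id antipode (comult h)) = (if counit h = {()} then one else \<bottom>)"
    and antipode_left:
      "h \<in> carrier H \<Longrightarrow>
         mult (tensor_map H H antipode id (comult h)) = (if counit h = {()} then one else \<bottom>)"

definition suplat_hopf_morphism ::
    "('a, 'x) gorder_scheme \<Rightarrow> (('a \<times> 'a) set \<Rightarrow> 'a) \<Rightarrow> 'a \<Rightarrow> ('a \<Rightarrow> ('a \<times> 'a) set)
        \<Rightarrow> ('a \<Rightarrow> unit set) \<Rightarrow> ('a \<Rightarrow> 'a)
      \<Rightarrow> ('b, 'y) gorder_scheme \<Rightarrow> (('b \<times> 'b) set \<Rightarrow> 'b) \<Rightarrow> 'b \<Rightarrow> ('b \<Rightarrow> ('b \<times> 'b) set)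
        \<Rightarrow> ('b \<Rightarrow> unit set) \<Rightarrow> ('b \<Rightarrow> 'b)
      \<Rightarrow> ('a \<Rightarrow> 'b) \<Rightarrow> bool" where
  "suplat_hopf_morphism H mult one comult counit antipode H' mult' one' comult' counit' antipode' f
     \<longleftrightarrow> f \<in> suplat_hom H H' \<and>
       (\<forall>t \<in> carrier (tensor H H). f (mult t) = mult' (tensor_map H' H' f f t)) \<and>
       f one = one' \<and>
       (\<forall>h \<in> carrier H. tensor_map H' H' f f (comult h) = comult' (f h)) \<and>
       (\<forall>h \<in> carrier H. counit h = counit' (f h)) \<and>
       (\<forall>h \<in> carrier H. f (antipode h) = antipode' (f h))"


section \<open>Coequalizers\<close>

text \<open>The universal property is tested against complete lattices over the type \<open>'k\<close>.\<close>

definition suplat_coequalizer ::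
    "'k itself \<Rightarrow> ('a, 'x) gorder_scheme \<Rightarrow> ('b, 'y) gorder_scheme \<Rightarrow> ('a \<Rightarrow> 'b) \<Rightarrow> ('a \<Rightarrow> 'b)
      \<Rightarrow> ('c, 'z) gorder_scheme \<Rightarrow> ('b \<Rightarrow> 'c) \<Rightarrow> bool" where
  "suplat_coequalizer (TK :: 'k itself) A B f g Q p \<longleftrightarrow>
     f \<in> suplat_hom A B \<and> g \<in> suplat_hom A B \<and> p \<in> suplat_hom B Q \<and>
     (\<forall>a \<in> carrier A. p (f a) = p (g a)) \<and>
     (\<forall>(K :: 'k gorder) r.
        r \<in> suplat_hom B K \<and> (\<forall>a \<in> carrier A. r (f a) = r (g a)) \<longrightarrow>
        (\<exists>u \<in> suplat_hom Q K. (\<forall>b \<in> carrier B. u (p b) = r b) \<and>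
           (\<forall>u' \<in> suplat_hom Q K. (\<forall>b \<in> carrier B. u' (p b) = r b) \<longrightarrow>
              (\<forall>q \<in> carrier Q. u' q = u q))))"

definition counit_kernel ::
    "('a, 'x) gorder_scheme \<Rightarrow> ('a \<Rightarrow> unit set) \<Rightarrow> ('a, 'x) gorder_scheme" where
  "counit_kernel H counit = H\<lparr>carrier := {h \<in> carrier H. counit h = {}}\<rparr>"

text \<open>The quotient of \<open>H\<close> by \<open>h \<sim> h \<squnion> D\<close>. Its carrier consists of sets of elements of \<open>H\<close>.
  The theorem \<open>suplat_quotient_coequalizer\<close> shows that for \<open>D = \<Squnion>\<epsilon>\<^sup>-\<^sup>1(\<emptyset>)\<close> it is the coequalizer of
  the pair \<open>\<emptyset>, inc\<close>, whatever the type of the test lattices. As the test lattices may be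
  taken to include this quotient, already the instance \<open>'k = 'h set\<close> of the universal property
  (where \<open>'h\<close> is the type of the elements of \<open>H\<close>) determines the coequalizer up to
  isomorphism.\<close>

definition join_rel :: "('a, 'x) gorder_scheme \<Rightarrow> 'a \<Rightarrow> ('a \<times> 'a) set" where
  "join_rel H D = {(a, b). a \<in> carrier H \<and> b \<in> carrier H \<and> a \<squnion>\<^bsub>H\<^esub> D = b \<squnion>\<^bsub>H\<^esub> D}"

definition suplat_quotient :: "('a, 'x) gorder_scheme \<Rightarrow> 'a \<Rightarrow> 'a set gorder" where
  "suplat_quotient H D =
     \<lparr>carrier = carrier H // join_rel H D, eq = (=),
      le = (\<lambda>X Y. \<exists>a\<in>X. \<exists>b\<in>Y. a \<squnion>\<^bsub>H\<^esub> D \<sqsubseteq>\<^bsub>H\<^esub> b \<squnion>\<^bsub>H\<^esub> D)\<rparr>"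

lemma P1_bottom: "\<bottom>\<^bsub>P1\<^esub> = {}"
proof -
  interpret P1: complete_lattice P1
    unfolding P1_def by (rule powerset_is_complete_lattice)
  show ?thesis using P1.bottom_lower[of "{}"] by (auto simp: P1_def)
qed

lemma suplat_hom_bottom:
  assumes "f \<in> suplat_hom L M"
  shows "f \<bottom>\<^bsub>L\<^esub> = \<bottom>\<^bsub>M\<^esub>"
proof -
  interpret L: complete_lattice L using suplat_homD(1)[OF assms] .
  interpret M: complete_lattice M using suplat_homD(2)[OF assms] .
  have "f (\<Squnion>\<^bsub>L\<^esub>{}) = \<Squnion>\<^bsub>M\<^esub>{}" using suplat_homD(4)[OF assms, of "{}"] by simp
  then show ?thesis using L.weak_sup_empty M.weak_sup_empty
    by (simp add: L.eq_is_equal M.eq_is_equal)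
qed

theorem suplat_quotient_coequalizer:
  fixes H :: "('h, 'x) gorder_scheme"
  assumes counit: "counit \<in> suplat_hom H P1"
  defines "D \<equiv> \<Squnion>\<^bsub>H\<^esub>{h \<in> carrier H. counit h = {}}"
  shows "suplat_coequalizer TYPE('k) (counit_kernel H counit) H (\<lambda>_. \<bottom>\<^bsub>H\<^esub>) (\<lambda>h. h)
           (suplat_quotient H D) (\<lambda>h. join_rel H D `` {h})"
proof -
  interpret H: complete_lattice H using suplat_homD(1)[OF counit] .
  interpret P1: complete_lattice P1 using suplat_homD(2)[OF counit] .
  let ?Z = "{h \<in> carrier H. counit h = {}}"
  let ?N = "counit_kernel H counit" and ?Q = "suplat_quotient H D"
  let ?p = "\<lambda>h. join_rel H D `` {h}"
  have Z: "?Z \<subseteq> carrier H" by auto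
  have D: "D \<in> carrier H" unfolding D_def using Z by (rule H.sup_closed)

  have sup_Z: "\<Squnion>\<^bsub>H\<^esub>A \<in> ?Z" if "A \<subseteq> ?Z" for A
  proof -
    have A: "A \<subseteq> carrier H" using that by auto
    have "counit (\<Squnion>\<^bsub>H\<^esub>A) = \<Squnion>\<^bsub>P1\<^esub>(counit ` A)" using suplat_homD(4)[OF counit A] .
    also have "\<dots> = {}"
    proof (rule P1.eq_by_upper)
      show "{} \<in> carrier P1" by (simp add: P1_def)
      have s: "counit ` A \<subseteq> carrier P1" using that by (auto simp: P1_def)
      then show "\<Squnion>\<^bsub>P1\<^esub>(counit ` A) \<in> carrier P1" by (rule P1.sup_closed)
      fix k assume "k \<in> carrier P1"
      from P1.sup_le_iff[OF s this]
      show "(\<Squnion>\<^bsub>P1\<^esub>(counit ` A) \<sqsubseteq>\<^bsub>P1\<^esub> k) = ({} \<sqsubseteq>\<^bsub>P1\<^esub> k)"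
        using that by (auto simp: P1_def)
    qed
    finally show ?thesis using A by auto
  qed
  have N_simps: "carrier ?N = ?Z" "(\<sqsubseteq>\<^bsub>?N\<^esub>) = (\<sqsubseteq>\<^bsub>H\<^esub>)" "(.=\<^bsub>?N\<^esub>) = (=)"
    by (simp_all add: counit_kernel_def H.eq_is_equal)
  interpret N: partial_order ?N
    by standard (auto simp: N_simps intro: H.le_trans H.le_antisym)
  have lub_N: "least ?N (\<Squnion>\<^bsub>H\<^esub>A) (Upper ?N A)" if "A \<subseteq> ?Z" for A
  proof -
    have A: "A \<subseteq> carrier H" using that by auto
    show ?thesis
    proof (rule least_UpperI)
      fix y assume "y \<in> Upper ?N A"
      then have "y \<in> carrier H" "\<And>x. x \<in> A \<Longrightarrow> x \<sqsubseteq>\<^bsub>H\<^esub> y"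
        using that by (auto simp: N_simps Upper_def)
      then show "\<Squnion>\<^bsub>H\<^esub>A \<sqsubseteq>\<^bsub>?N\<^esub> y" unfolding N_simps using A by (intro H.sup_least)
    qed (use sup_Z[OF that] that H.sup_upper[OF A] in \<open>auto simp: N_simps\<close>)
  qed
  have N: "complete_lattice ?N"
    by (rule complete_lattice_supI) (use lub_N in \<open>auto simp: N_simps intro: N.partial_order_axioms\<close>)
  interpret N: complete_lattice ?N by (rule N)
  have sup_N: "\<Squnion>\<^bsub>?N\<^esub>A = \<Squnion>\<^bsub>H\<^esub>A" if "A \<subseteq> ?Z" for A
    using N.least_unique[OF N.sup_lub lub_N] that by (simp add: N_simps)

  have inc: "(\<lambda>h. h) \<in> suplat_hom ?N H"
    by (rule suplat_homI) (use N H.complete_lattice_axioms sup_N in \<open>auto simp: N_simps\<close>)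
  have zero: "(\<lambda>_. \<bottom>\<^bsub>H\<^esub>) \<in> suplat_hom ?N H"
  proof (rule suplat_homI)
    fix A assume "A \<subseteq> carrier ?N"
    show "\<bottom>\<^bsub>H\<^esub> = \<Squnion>\<^bsub>H\<^esub>((\<lambda>_. \<bottom>\<^bsub>H\<^esub>) ` A)"
    proof (cases "A = {}")
      case True
      then show ?thesis using H.weak_sup_empty by (simp add: H.eq_is_equal)
    next
      case False
      then have "(\<lambda>_. \<bottom>\<^bsub>H\<^esub>) ` A = {\<bottom>\<^bsub>H\<^esub>}" by auto
      then show ?thesis by simp
    qed
  qed (use N H.complete_lattice_axioms in auto)

  have jc: "h \<squnion>\<^bsub>H\<^esub> D \<in> carrier H" if "h \<in> carrier H" for h using that D by simp
  have p_iff: "x \<in> ?p h \<longleftrightarrow> x \<in> carrier H \<and> x \<squnion>\<^bsub>H\<^esub> D = h \<squnion>\<^bsub>H\<^esub> D" if "h \<in> carrier H" for x h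
    using that by (auto simp: join_rel_def)
  have Q_simps: "carrier ?Q = ?p ` carrier H" "(.=\<^bsub>?Q\<^esub>) = (=)"
    by (auto simp: suplat_quotient_def quotient_def)
  have p_le: "?p a \<sqsubseteq>\<^bsub>?Q\<^esub> ?p b \<longleftrightarrow> a \<squnion>\<^bsub>H\<^esub> D \<sqsubseteq>\<^bsub>H\<^esub> b \<squnion>\<^bsub>H\<^esub> D"
    if "a \<in> carrier H" "b \<in> carrier H" for a b
    using that by (auto simp: suplat_quotient_def join_rel_def)
  have p_eq: "?p a = ?p b \<longleftrightarrow> a \<squnion>\<^bsub>H\<^esub> D = b \<squnion>\<^bsub>H\<^esub> D" if "a \<in> carrier H" "b \<in> carrier H" for a b
    using that by (auto simp: join_rel_def set_eq_iff)
  have join_le_iff: "a \<squnion>\<^bsub>H\<^esub> D \<sqsubseteq>\<^bsub>H\<^esub> b \<squnion>\<^bsub>H\<^esub> D \<longleftrightarrow> a \<sqsubseteq>\<^bsub>H\<^esub> b \<squnion>\<^bsub>H\<^esub> D"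
    if "a \<in> carrier H" "b \<in> carrier H" for a b
  proof
    show "a \<sqsubseteq>\<^bsub>H\<^esub> b \<squnion>\<^bsub>H\<^esub> D" if "a \<squnion>\<^bsub>H\<^esub> D \<sqsubseteq>\<^bsub>H\<^esub> b \<squnion>\<^bsub>H\<^esub> D"
      using H.le_trans[OF H.join_left that] \<open>a \<in> _\<close> \<open>b \<in> _\<close> D jc by simp
    show "a \<squnion>\<^bsub>H\<^esub> D \<sqsubseteq>\<^bsub>H\<^esub> b \<squnion>\<^bsub>H\<^esub> D" if "a \<sqsubseteq>\<^bsub>H\<^esub> b \<squnion>\<^bsub>H\<^esub> D"
      using that H.join_right[of b D] \<open>a \<in> _\<close> \<open>b \<in> _\<close> D jc by (intro H.join_le) auto
  qed
  interpret Q: partial_order ?Q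
  proof
    fix x y z assume "x \<in> carrier ?Q" "y \<in> carrier ?Q" "z \<in> carrier ?Q"
    then obtain a b c where abc: "a \<in> carrier H" "x = ?p a" "b \<in> carrier H" "y = ?p b"
        "c \<in> carrier H" "z = ?p c"
      by (auto simp: Q_simps)
    show "x \<sqsubseteq>\<^bsub>?Q\<^esub> y \<Longrightarrow> y \<sqsubseteq>\<^bsub>?Q\<^esub> z \<Longrightarrow> x \<sqsubseteq>\<^bsub>?Q\<^esub> z"
      using abc p_le jc H.le_trans[of "a \<squnion>\<^bsub>H\<^esub> D" "b \<squnion>\<^bsub>H\<^esub> D" "c \<squnion>\<^bsub>H\<^esub> D"] by simp
  next
    fix x y assume "x \<in> carrier ?Q" "y \<in> carrier ?Q"
    then obtain a b where abc: "a \<in> carrier H" "x = ?p a" "b \<in> carrier H" "y = ?p b"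
      by (auto simp: Q_simps)
    show "x \<sqsubseteq>\<^bsub>?Q\<^esub> y \<Longrightarrow> y \<sqsubseteq>\<^bsub>?Q\<^esub> x \<Longrightarrow> x .=\<^bsub>?Q\<^esub> y"
      using abc p_le p_eq jc H.le_antisym by (simp add: Q_simps)
  next
    fix x assume "x \<in> carrier ?Q"
    then obtain a where "a \<in> carrier H" "x = ?p a" by (auto simp: Q_simps)
    then show "x \<sqsubseteq>\<^bsub>?Q\<^esub> x" using p_le jc by simp
  qed (auto simp: Q_simps)
  have lub_Q: "least ?Q (?p (\<Squnion>\<^bsub>H\<^esub>A)) (Upper ?Q (?p ` A))" if A: "A \<subseteq> carrier H" for A
  proof (rule least_UpperI)
    fix x assume "x \<in> ?p ` A"
    then obtain a where a: "a \<in> A" "x = ?p a" by auto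
    have "a \<sqsubseteq>\<^bsub>H\<^esub> \<Squnion>\<^bsub>H\<^esub>A" using A a H.sup_upper by blast
    moreover have "\<Squnion>\<^bsub>H\<^esub>A \<sqsubseteq>\<^bsub>H\<^esub> \<Squnion>\<^bsub>H\<^esub>A \<squnion>\<^bsub>H\<^esub> D" using A D H.join_left by simp
    ultimately have "a \<sqsubseteq>\<^bsub>H\<^esub> \<Squnion>\<^bsub>H\<^esub>A \<squnion>\<^bsub>H\<^esub> D"
      using A a jc H.le_trans[of a "\<Squnion>\<^bsub>H\<^esub>A" "\<Squnion>\<^bsub>H\<^esub>A \<squnion>\<^bsub>H\<^esub> D"] by auto
    then show "x \<sqsubseteq>\<^bsub>?Q\<^esub> ?p (\<Squnion>\<^bsub>H\<^esub>A)"
      using a A join_le_iff[of a "\<Squnion>\<^bsub>H\<^esub>A"] p_le[of a "\<Squnion>\<^bsub>H\<^esub>A"] by auto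
  next
    fix y assume "y \<in> Upper ?Q (?p ` A)"
    then have ub: "\<forall>x \<in> ?p ` A \<inter> carrier ?Q. x \<sqsubseteq>\<^bsub>?Q\<^esub> y" and y: "y \<in> carrier ?Q"
      by (auto simp: Upper_def)
    obtain b where b: "b \<in> carrier H" "y = ?p b" using y by (auto simp: Q_simps)
    have "a \<sqsubseteq>\<^bsub>H\<^esub> b \<squnion>\<^bsub>H\<^esub> D" if "a \<in> A" for a
    proof -
      have a: "a \<in> carrier H" using that A by auto
      have "?p a \<sqsubseteq>\<^bsub>?Q\<^esub> ?p b" using ub that a b by (auto simp: Q_simps)
      then show ?thesis using p_le join_le_iff a b by simp
    qed
    then have "\<Squnion>\<^bsub>H\<^esub>A \<sqsubseteq>\<^bsub>H\<^esub> b \<squnion>\<^bsub>H\<^esub> D" using A b jc H.sup_least by simp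
    then show "?p (\<Squnion>\<^bsub>H\<^esub>A) \<sqsubseteq>\<^bsub>?Q\<^esub> y" using A b p_le join_le_iff by simp
  qed (use A in \<open>auto simp: Q_simps\<close>)
  have Q: "complete_lattice ?Q"
  proof (rule complete_lattice_supI)
    fix A assume "A \<subseteq> carrier ?Q"
    then obtain B where "B \<subseteq> carrier H" "A = ?p ` B"
      unfolding Q_simps by (meson subset_imageE)
    then show "\<exists>s. least ?Q s (Upper ?Q A)" using lub_Q by blast
  qed (rule Q.partial_order_axioms)
  interpret Q: complete_lattice ?Q by (rule Q)
  have p: "?p \<in> suplat_hom H ?Q"
  proof (rule suplat_homI)
    fix A assume A: "A \<subseteq> carrier H"
    then have "?p ` A \<subseteq> carrier ?Q" by (auto simp: Q_simps)
    then show "?p (\<Squnion>\<^bsub>H\<^esub>A) = \<Squnion>\<^bsub>?Q\<^esub>(?p ` A)"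
      using Q.least_unique[OF lub_Q[OF A] Q.sup_lub] by simp
  qed (use Q H.complete_lattice_axioms in \<open>auto simp: Q_simps\<close>)

  have coeq: "?p \<bottom>\<^bsub>H\<^esub> = ?p a" if "a \<in> carrier ?N" for a
  proof -
    have a: "a \<in> ?Z" using that by (simp add: N_simps)
    then have aH: "a \<in> carrier H" by simp
    have aD: "a \<sqsubseteq>\<^bsub>H\<^esub> D" unfolding D_def using Z a by (rule H.sup_upper)
    have j: "x \<squnion>\<^bsub>H\<^esub> D = D" if "x \<in> carrier H" "x \<sqsubseteq>\<^bsub>H\<^esub> D" for x
      using that D jc H.join_right[of x D] H.join_le[of x D D]
      by (intro H.le_antisym) auto
    show ?thesis
      using p_eq[of "\<bottom>\<^bsub>H\<^esub>" a] j[of "\<bottom>\<^bsub>H\<^esub>"] j[OF aH aD] aH D H.bottom_lower by simp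
  qed

  have univ: "\<exists>u \<in> suplat_hom ?Q K. (\<forall>b \<in> carrier H. u (?p b) = r b) \<and>
      (\<forall>u' \<in> suplat_hom ?Q K. (\<forall>b \<in> carrier H. u' (?p b) = r b) \<longrightarrow> (\<forall>q \<in> carrier ?Q. u' q = u q))"
    if r: "r \<in> suplat_hom H K" and eq: "\<forall>a \<in> carrier ?N. r \<bottom>\<^bsub>H\<^esub> = r a"
    for K :: "'k gorder" and r
  proof -
    interpret K: complete_lattice K using suplat_homD(2)[OF r] .
    note rc = suplat_homD(3)[OF r] and rs = suplat_homD(4)[OF r]
    have "\<bottom>\<^bsub>H\<^esub> \<in> ?Z"
      using suplat_hom_bottom[OF counit] by (simp add: P1_bottom)
    then have "r ` ?Z = {r \<bottom>\<^bsub>H\<^esub>}" using eq by (force simp: N_simps)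
    then have "r D = r \<bottom>\<^bsub>H\<^esub>" unfolding D_def using rs[OF Z] rc by simp
    then have rD: "r D = \<bottom>\<^bsub>K\<^esub>" using suplat_hom_bottom[OF r] by simp
    have r_join: "r (h \<squnion>\<^bsub>H\<^esub> D) = r h" if h: "h \<in> carrier H" for h
    proof -
      have "r (h \<squnion>\<^bsub>H\<^esub> D) = r h \<squnion>\<^bsub>K\<^esub> \<bottom>\<^bsub>K\<^esub>"
        unfolding join_def using rs[of "{h, D}"] h D rD by simp
      also have "\<dots> = r h"
        using rc[OF h] K.join_left[of "r h" "\<bottom>\<^bsub>K\<^esub>"]
        by (intro K.le_antisym K.join_le K.bottom_lower K.le_refl) auto
      finally show ?thesis .
    qed
    define u where "u X = r (SOME h. h \<in> X)" for X
    have up: "u (?p h) = r h" if h: "h \<in> carrier H" for h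
    proof -
      have "h \<in> ?p h" using h p_iff by simp
      then have "(SOME x. x \<in> ?p h) \<in> ?p h" by (rule someI)
      then show ?thesis unfolding u_def using r_join p_iff[OF h] h by metis
    qed
    have "u \<in> suplat_hom ?Q K"
    proof (rule suplat_homI)
      fix A assume "A \<subseteq> carrier ?Q"
      then obtain B where B: "B \<subseteq> carrier H" "A = ?p ` B"
        unfolding Q_simps by (meson subset_imageE)
      have "u (\<Squnion>\<^bsub>?Q\<^esub>A) = r (\<Squnion>\<^bsub>H\<^esub>B)"
        using suplat_homD(4)[OF p B(1)] up[of "\<Squnion>\<^bsub>H\<^esub>B"] B by simp
      also have "\<dots> = \<Squnion>\<^bsub>K\<^esub>(r ` B)" using rs[OF B(1)] .
      also have "r ` B = u ` A" unfolding B(2) image_image using up B(1) by (intro image_cong) auto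
      finally show "u (\<Squnion>\<^bsub>?Q\<^esub>A) = \<Squnion>\<^bsub>K\<^esub>(u ` A)" .
    qed (use Q K.complete_lattice_axioms rc up in \<open>auto simp: Q_simps\<close>)
    moreover have "\<forall>q \<in> carrier ?Q. u' q = u q" if "\<forall>b \<in> carrier H. u' (?p b) = r b" for u'
      using that up by (auto simp: Q_simps)
    ultimately show ?thesis using up by blast
  qed

  show ?thesis
    unfolding suplat_coequalizer_def using zero inc p coeq univ by blast
qed

end

theory Submission
  imports Defs
begin

text \<open>The coequalizer \<open>\<pi>\<close> is surjective, and a join-preserving map \<open>r\<close> from \<open>H\<close> to any complete
  lattice factors through \<open>\<pi>\<close> as soon as \<open>\<epsilon>(h) = \<emptyset>\<close> implies \<open>r(h) = \<bottom>\<close>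
  (\<open>suplat_coequalizer_surj\<close>, \<open>suplat_coequalizer_factor\<close>). So every structural map of \<open>H\<close>, followed
  by \<open>\<pi>\<close> or \<open>\<pi> \<otimes> \<pi>\<close>, has to be shown to vanish on \<open>\<epsilon>\<^sup>-\<^sup>1(\<emptyset>)\<close>.

  For the counit there is nothing to do, and for the multiplication this is the multiplicativity of
  \<open>\<epsilon>\<close>. For the other maps the key is a pointwise form of the counit law: since \<open>P(1)\<close> has only two
  elements, \<open>h = (\<epsilon> \<otimes> id)\<Delta>(h)\<close> says that \<open>h\<close> is the join of those \<open>b\<close> that occur in a pair
  \<open>(a, b) \<le> \<Delta>(h)\<close> with \<open>\<epsilon>(a) = 1\<close>. Hence \<open>r(h) = \<emptyset>\<close>, for a join-preserving \<open>r : H \<rightarrow> P(1)\<close>, if and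
  only if \<open>\<epsilon>(a) = \<emptyset>\<close> or \<open>r(b) = \<emptyset>\<close> for all pairs \<open>(a, b) \<le> \<Delta>(h)\<close>
  (\<open>hom_empty_iff_comult\<close>).

  With \<open>r = \<epsilon>\<close> this shows that \<open>\<epsilon>(h) = \<emptyset>\<close> forces \<open>\<pi>(a) \<otimes> \<pi>(b) = \<bottom>\<close> for all those pairs, and
  so \<open>(\<pi> \<otimes> \<pi>)\<Delta>(h) = \<bottom>\<close>: the comultiplication descends. With \<open>r = \<epsilon>S\<close> the right-hand side says
  that \<open>\<epsilon>\<close> vanishes on \<open>m(id \<otimes> S)\<Delta>(h)\<close>, which by the antipode law happens exactly if
  \<open>\<epsilon>(h) = \<emptyset>\<close>. Thus \<open>\<epsilon>S = \<epsilon>\<close> (\<open>counit_antipode_empty_iff\<close>), and both the antipode and its inverse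
  descend.

  The axioms for \<open>Q\<close> then follow from those for \<open>H\<close>, because \<open>\<pi>\<close> is surjective and commutes with
  the induced maps, and because the associator, the unitors and the componentwise product of the
  tensor square are natural.\<close>

section \<open>Join-preserving maps\<close>

lemma suplat_hom_comp:
  assumes "f \<in> suplat_hom L M" "g \<in> suplat_hom M K"
  shows "(\<lambda>x. g (f x)) \<in> suplat_hom L K"
proof (rule suplat_homI)
  note f = suplat_homD[OF assms(1)] and g = suplat_homD[OF assms(2)]
  show "complete_lattice L" "complete_lattice K" by (fact f g)+
  show "g (f x) \<in> carrier K" if "x \<in> carrier L" for x using f g that by blast
  fix A assume A: "A \<subseteq> carrier L"
  then have "f ` A \<subseteq> carrier M" using f by blast
  then show "g (f (\<Squnion>\<^bsub>L\<^esub>A)) = \<Squnion>\<^bsub>K\<^esub>((\<lambda>x. g (f x)) ` A)"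
    using f(4)[OF A] g(4) by (simp add: image_image)
qed

lemma suplat_hom_ident: "complete_lattice L \<Longrightarrow> (\<lambda>x. x) \<in> suplat_hom L L"
  by (rule suplat_homI) auto

lemma suplat_hom_id: "complete_lattice L \<Longrightarrow> id \<in> suplat_hom L L"
  using suplat_hom_ident by (simp add: id_def)

lemma suplat_bihomD:
  assumes "f \<in> suplat_bihom L M K"
  shows "l \<in> carrier L \<Longrightarrow> f l \<in> suplat_hom M K"
    and "m \<in> carrier M \<Longrightarrow> (\<lambda>l. f l m) \<in> suplat_hom L K"
    and "l \<in> carrier L \<Longrightarrow> m \<in> carrier M \<Longrightarrow> f l m \<in> carrier K"
  using assms suplat_homD(3)[of "f l" M K m] by (simp_all add: suplat_bihom_def)

lemma suplat_bihomI:
  assumes "\<And>l. l \<in> carrier L \<Longrightarrow> f l \<in> suplat_hom M K"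
    and "\<And>m. m \<in> carrier M \<Longrightarrow> (\<lambda>l. f l m) \<in> suplat_hom L K"
  shows "f \<in> suplat_bihom L M K"
  using assms by (simp add: suplat_bihom_def)

lemma suplat_bihom_comp_hom:
  assumes "f \<in> suplat_bihom L M K" "g \<in> suplat_hom K K'"
  shows "(\<lambda>l m. g (f l m)) \<in> suplat_bihom L M K'"
  using suplat_hom_comp[OF suplat_bihomD(1)[OF assms(1)] assms(2)]
    suplat_hom_comp[OF suplat_bihomD(2)[OF assms(1)] assms(2)]
  by (rule suplat_bihomI)

lemma suplat_bihom_comp_homs:
  assumes "f \<in> suplat_hom L L'" "g \<in> suplat_hom M M'" "h \<in> suplat_bihom L' M' K"
  shows "(\<lambda>l m. h (f l) (g m)) \<in> suplat_bihom L M K"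
proof (rule suplat_bihomI)
  show "(\<lambda>m. h (f l) (g m)) \<in> suplat_hom M K" if "l \<in> carrier L" for l
    by (rule suplat_hom_comp[OF assms(2)]) (rule suplat_bihomD(1)[OF assms(3) suplat_homD(3)[OF assms(1) that]])
  show "(\<lambda>l. h (f l) (g m)) \<in> suplat_hom L K" if "m \<in> carrier M" for m
    using suplat_hom_comp[OF assms(1) suplat_bihomD(2)[OF assms(3) suplat_homD(3)[OF assms(2) that]]] .
qed

text \<open>Joins in \<open>K\<close> over two independent indices may be taken in either order.\<close>

lemma suplat_hom_pointwise_sup:
  assumes N: "complete_lattice N" and K: "complete_lattice K"
    and g: "\<And>i. i \<in> I \<Longrightarrow> g i \<in> suplat_hom N K"
  shows "(\<lambda>n. \<Squnion>\<^bsub>K\<^esub>((\<lambda>i. g i n) ` I)) \<in> suplat_hom N K"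
proof (rule suplat_homI)
  interpret N: complete_lattice N by fact
  interpret K: complete_lattice K by fact
  have im: "(\<lambda>i. g i n) ` I \<subseteq> carrier K" if "n \<in> carrier N" for n
    using suplat_homD(3)[OF g that] by blast
  show closed: "\<Squnion>\<^bsub>K\<^esub>((\<lambda>i. g i n) ` I) \<in> carrier K" if "n \<in> carrier N" for n
    using im[OF that] by (rule K.sup_closed)
  fix A assume A: "A \<subseteq> carrier N"
  then have sA: "\<Squnion>\<^bsub>N\<^esub>A \<in> carrier N" by (rule N.sup_closed)
  have imA: "(\<lambda>n. \<Squnion>\<^bsub>K\<^esub>((\<lambda>i. g i n) ` I)) ` A \<subseteq> carrier K" using closed A by blast
  show "\<Squnion>\<^bsub>K\<^esub>((\<lambda>i. g i (\<Squnion>\<^bsub>N\<^esub>A)) ` I) = \<Squnion>\<^bsub>K\<^esub>((\<lambda>n. \<Squnion>\<^bsub>K\<^esub>((\<lambda>i. g i n) ` I)) ` A)"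
  proof (rule K.eq_by_upper)
    fix k assume k: "k \<in> carrier K"
    have 1: "g i (\<Squnion>\<^bsub>N\<^esub>A) \<sqsubseteq>\<^bsub>K\<^esub> k \<longleftrightarrow> (\<forall>a\<in>A. g i a \<sqsubseteq>\<^bsub>K\<^esub> k)" if i: "i \<in> I" for i
    proof -
      have "g i ` A \<subseteq> carrier K" using suplat_homD(3)[OF g[OF i]] A by blast
      then show ?thesis using suplat_homD(4)[OF g[OF i] A] K.sup_le_iff[OF _ k] by simp
    qed
    have 2: "\<Squnion>\<^bsub>K\<^esub>((\<lambda>i. g i a) ` I) \<sqsubseteq>\<^bsub>K\<^esub> k \<longleftrightarrow> (\<forall>i\<in>I. g i a \<sqsubseteq>\<^bsub>K\<^esub> k)" if "a \<in> carrier N" for a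
      using K.sup_le_iff[OF im[OF that] k] by simp
    have "\<Squnion>\<^bsub>K\<^esub>((\<lambda>n. \<Squnion>\<^bsub>K\<^esub>((\<lambda>i. g i n) ` I)) ` A) \<sqsubseteq>\<^bsub>K\<^esub> k \<longleftrightarrow> (\<forall>a\<in>A. \<forall>i\<in>I. g i a \<sqsubseteq>\<^bsub>K\<^esub> k)"
      unfolding K.sup_le_iff[OF imA k] using A by (simp add: 2 subset_iff)
    moreover have "\<Squnion>\<^bsub>K\<^esub>((\<lambda>i. g i (\<Squnion>\<^bsub>N\<^esub>A)) ` I) \<sqsubseteq>\<^bsub>K\<^esub> k \<longleftrightarrow> (\<forall>a\<in>A. \<forall>i\<in>I. g i a \<sqsubseteq>\<^bsub>K\<^esub> k)"
      unfolding 2[OF sA] by (auto simp: 1)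
    ultimately show "(\<Squnion>\<^bsub>K\<^esub>((\<lambda>i. g i (\<Squnion>\<^bsub>N\<^esub>A)) ` I) \<sqsubseteq>\<^bsub>K\<^esub> k) =
        (\<Squnion>\<^bsub>K\<^esub>((\<lambda>n. \<Squnion>\<^bsub>K\<^esub>((\<lambda>i. g i n) ` I)) ` A) \<sqsubseteq>\<^bsub>K\<^esub> k)" by simp
  qed (rule closed[OF sA], rule K.sup_closed[OF imA])
qed (fact N K)+

lemma suplat_hom_of_comp_surj:
  assumes p: "p \<in> suplat_hom B Q" and surj: "p ` carrier B = carrier Q"
    and r: "r \<in> suplat_hom B K" and u: "\<And>b. b \<in> carrier B \<Longrightarrow> u (p b) = r b"
  shows "u \<in> suplat_hom Q K"
proof (rule suplat_homI)
  interpret B: complete_lattice B using suplat_homD(1)[OF p] .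
  show "complete_lattice Q" "complete_lattice K" using suplat_homD(2) p r by blast+
  show "u x \<in> carrier K" if "x \<in> carrier Q" for x
    using that unfolding surj[symmetric] by (auto simp: u suplat_homD(3)[OF r])
  fix A assume "A \<subseteq> carrier Q"
  then obtain C where C: "C \<subseteq> carrier B" "A = p ` C"
    unfolding surj[symmetric] by (meson subset_imageE)
  have "u (\<Squnion>\<^bsub>Q\<^esub>A) = r (\<Squnion>\<^bsub>B\<^esub>C)"
    using suplat_homD(4)[OF p C(1)] u[of "\<Squnion>\<^bsub>B\<^esub>C"] C by simp
  also have "\<dots> = \<Squnion>\<^bsub>K\<^esub>(r ` C)" using suplat_homD(4)[OF r C(1)] .
  also have "r ` C = u ` A" unfolding C(2) image_image using u C(1) by (intro image_cong) auto
  finally show "u (\<Squnion>\<^bsub>Q\<^esub>A) = \<Squnion>\<^bsub>K\<^esub>(u ` A)" .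
qed


section \<open>Coequalizers are tested by the two-element lattice\<close>

text \<open>A join-preserving map to the two-element lattice is the same as an element \<open>k\<close> of its domain: the
  map sends the elements below \<open>k\<close> to \<open>\<emptyset>\<close> and the others to the top. These maps separate
  points, so a universal property that is tested only against lattices over one fixed type \<open>'c set\<close>,
  which always contains a two-element lattice, already has force for lattices over all types.\<close>

definition two :: "'c set gorder" where
  "two = \<lparr>carrier = {{}, UNIV}, eq = (=), le = (\<subseteq>)\<rparr>"

definition not_below :: "('a, 'x) gorder_scheme \<Rightarrow> 'a \<Rightarrow> 'a \<Rightarrow> 'c set" where
  "not_below L k x = (if x \<sqsubseteq>\<^bsub>L\<^esub> k then {} else UNIV)"

lemma complete_lattice_two: "complete_lattice (two :: 'c set gorder)"
proof -
  interpret partial_order "two :: 'c set gorder" by standard (auto simp: two_def)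
  show ?thesis
  proof (rule complete_lattice_supI)
    fix A :: "'c set set" assume A: "A \<subseteq> carrier two"
    then have "\<Union>A \<in> carrier two" by (auto simp: two_def)
    then have "least two (\<Union>A) (Upper two A)"
      using A by (fastforce simp: least_def Upper_def two_def)
    then show "\<exists>s. least two s (Upper two A)" ..
  qed (rule partial_order_axioms)
qed

lemma not_below_hom:
  assumes L: "complete_lattice L" and k: "k \<in> carrier L"
  shows "not_below L k \<in> suplat_hom L (two :: 'c set gorder)"
proof (rule suplat_homI)
  interpret L: complete_lattice L by fact
  interpret T: complete_lattice "two :: 'c set gorder" by (rule complete_lattice_two)
  show closed: "not_below L k x \<in> carrier (two :: 'c set gorder)" for x
    by (simp add: not_below_def two_def)
  fix A assume A: "A \<subseteq> carrier L"
  have im: "not_below L k ` A \<subseteq> carrier (two :: 'c set gorder)" using closed by blast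
  show "not_below L k (\<Squnion>\<^bsub>L\<^esub>A) = \<Squnion>\<^bsub>two :: 'c set gorder\<^esub>(not_below L k ` A)"
  proof (rule T.eq_by_upper)
    fix t :: "'c set" assume t: "t \<in> carrier two"
    show "(not_below L k (\<Squnion>\<^bsub>L\<^esub>A) \<sqsubseteq>\<^bsub>two\<^esub> t) = (\<Squnion>\<^bsub>two\<^esub>(not_below L k ` A) \<sqsubseteq>\<^bsub>two\<^esub> t)"
      unfolding T.sup_le_iff[OF im t] using L.sup_le_iff[OF A k] t
      by (auto simp: not_below_def two_def)
  qed (rule closed, rule T.sup_closed[OF im])
qed (fact L complete_lattice_two)+

lemma not_below_eq: "not_below L k x = (not_below L k' x' :: 'c set) \<longleftrightarrow> (x \<sqsubseteq>\<^bsub>L\<^esub> k \<longleftrightarrow> x' \<sqsubseteq>\<^bsub>L\<^esub> k')"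
  by (simp add: not_below_def)

text \<open>For an element \<open>q\<close> of \<open>Q\<close> let \<open>p b\<close> be the largest element of the image of \<open>p\<close> below \<open>q\<close>. The
  maps to the two-element lattice that belong to \<open>q\<close> and to \<open>p b\<close> agree on the image of \<open>p\<close>, hence
  are equal by the uniqueness of factorizations; this means \<open>q = p b\<close>.\<close>

lemma suplat_coequalizer_surj:
  assumes "suplat_coequalizer TYPE('c set) A B f g Q p"
  shows "p ` carrier B = carrier Q"
proof
  have p: "p \<in> suplat_hom B Q" and eq: "\<And>a. a \<in> carrier A \<Longrightarrow> p (f a) = p (g a)"
    and univ: "\<And>(K :: 'c set gorder) r. r \<in> suplat_hom B K \<Longrightarrow> \<forall>a \<in> carrier A. r (f a) = r (g a) \<Longrightarrow>
      \<exists>u \<in> suplat_hom Q K. (\<forall>b \<in> carrier B. u (p b) = r b) \<and>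
           (\<forall>u' \<in> suplat_hom Q K. (\<forall>b \<in> carrier B. u' (p b) = r b) \<longrightarrow>
              (\<forall>q \<in> carrier Q. u' q = u q))"
    using assms unfolding suplat_coequalizer_def by blast+
  interpret B: complete_lattice B using suplat_homD(1)[OF p] .
  interpret Q: complete_lattice Q using suplat_homD(2)[OF p] .
  show "p ` carrier B \<subseteq> carrier Q" using suplat_homD(3)[OF p] by blast
  show "carrier Q \<subseteq> p ` carrier B"
  proof
    fix q assume q: "q \<in> carrier Q"
    let ?A = "{b \<in> carrier B. p b \<sqsubseteq>\<^bsub>Q\<^esub> q}"
    let ?b = "\<Squnion>\<^bsub>B\<^esub>?A"
    have A: "?A \<subseteq> carrier B" by auto
    then have b: "?b \<in> carrier B" by (rule B.sup_closed)
    then have pb: "p ?b \<in> carrier Q" using suplat_homD(3)[OF p] by blast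
    have pA: "p ` ?A \<subseteq> carrier Q" using suplat_homD(3)[OF p] by blast
    have pb_eq: "p ?b = \<Squnion>\<^bsub>Q\<^esub>(p ` ?A)" using suplat_homD(4)[OF p A] .
    have le: "p ?b \<sqsubseteq>\<^bsub>Q\<^esub> q" unfolding pb_eq using Q.sup_le_iff[OF pA q] by blast
    have agree: "p x \<sqsubseteq>\<^bsub>Q\<^esub> p ?b \<longleftrightarrow> p x \<sqsubseteq>\<^bsub>Q\<^esub> q" if x: "x \<in> carrier B" for x
    proof
      show "p x \<sqsubseteq>\<^bsub>Q\<^esub> q" if "p x \<sqsubseteq>\<^bsub>Q\<^esub> p ?b"
        using Q.le_trans[OF that le] suplat_homD(3)[OF p x] pb q by blast
      show "p x \<sqsubseteq>\<^bsub>Q\<^esub> p ?b" if "p x \<sqsubseteq>\<^bsub>Q\<^esub> q"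
        unfolding pb_eq using that x by (intro Q.sup_upper[OF pA]) blast
    qed
    let ?t = "not_below Q q :: _ \<Rightarrow> 'c set" and ?t' = "not_below Q (p ?b) :: _ \<Rightarrow> 'c set"
    have t: "?t \<in> suplat_hom Q two" and t': "?t' \<in> suplat_hom Q two"
      using not_below_hom[OF Q.complete_lattice_axioms] q pb by blast+
    have "\<forall>a\<in>carrier A. ?t (p (f a)) = ?t (p (g a))" using eq by simp
    from univ[OF suplat_hom_comp[OF p t] this]
    obtain u where u: "\<forall>u' \<in> suplat_hom Q two. (\<forall>b \<in> carrier B. u' (p b) = ?t (p b)) \<longrightarrow>
        (\<forall>q \<in> carrier Q. u' q = u q)"
      by (elim bexE conjE) (rule that)
    have "?t' q = u q" using agree by (intro u[rule_format, OF t' _ q]) (simp add: not_below_eq)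
    moreover have "?t q = u q" by (rule u[rule_format, OF t _ q]) simp
    ultimately have "?t q = ?t' q" by simp
    then have "q \<sqsubseteq>\<^bsub>Q\<^esub> p ?b" using q Q.le_refl by (simp add: not_below_eq)
    then have "q = p ?b" using le q pb Q.le_antisym by blast
    then show "q \<in> p ` carrier B" using b by blast
  qed
qed

text \<open>Here \<open>K\<close> may live on any type. If \<open>p b = p b'\<close> then \<open>r b \<le> r b'\<close>, as is seen by factoring through
  \<open>p\<close> the composite of \<open>r\<close> with the map to the two-element lattice that belongs to \<open>r b'\<close>. By
  symmetry \<open>r\<close> is constant on the fibres of \<open>p\<close>.\<close>

lemma suplat_coequalizer_factor:
  assumes coeq: "suplat_coequalizer TYPE('c set) A B f g Q p"
    and r: "r \<in> suplat_hom B K" and eq: "\<And>a. a \<in> carrier A \<Longrightarrow> r (f a) = r (g a)"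
  shows "\<exists>u \<in> suplat_hom Q K. \<forall>b \<in> carrier B. u (p b) = r b"
proof -
  have p: "p \<in> suplat_hom B Q"
    and univ: "\<And>(K :: 'c set gorder) r. r \<in> suplat_hom B K \<Longrightarrow> \<forall>a \<in> carrier A. r (f a) = r (g a) \<Longrightarrow>
      \<exists>u \<in> suplat_hom Q K. \<forall>b \<in> carrier B. u (p b) = r b"
    using coeq unfolding suplat_coequalizer_def by blast+
  interpret K: complete_lattice K using suplat_homD(2)[OF r] .
  note rc = suplat_homD(3)[OF r]
  have le: "r b \<sqsubseteq>\<^bsub>K\<^esub> r b'" if b: "b \<in> carrier B" and b': "b' \<in> carrier B" and "p b = p b'" for b b'
  proof -
    let ?t = "\<lambda>x. not_below K (r b') (r x) :: 'c set"
    have "?t \<in> suplat_hom B two"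
      by (rule suplat_hom_comp[OF r not_below_hom[OF K.complete_lattice_axioms rc[OF b']]])
    then obtain u where "\<forall>b \<in> carrier B. u (p b) = ?t b"
      using univ eq by (metis (no_types, lifting))
    then have "?t b = ?t b'" using b b' \<open>p b = p b'\<close> by metis
    then show ?thesis using K.le_refl[OF rc[OF b']] by (simp add: not_below_eq)
  qed
  define u where "u q = r (inv_into (carrier B) p q)" for q
  have "u (p b) = r b" if b: "b \<in> carrier B" for b
  proof -
    have "inv_into (carrier B) p (p b) \<in> carrier B" "p (inv_into (carrier B) p (p b)) = p b"
      using b by (auto intro: inv_into_into f_inv_into_f)
    then show ?thesis unfolding u_def using le b rc K.le_antisym by metis
  qed
  moreover from this have "u \<in> suplat_hom Q K"
    by (rule suplat_hom_of_comp_surj[OF p suplat_coequalizer_surj[OF coeq] r])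
  ultimately show ?thesis by blast
qed


section \<open>Maps out of tensor products\<close>

lemma tensor_hom_ext:
  assumes L: "complete_lattice L" and M: "complete_lattice M"
    and g: "g \<in> suplat_hom (tensor L M) K" and h: "h \<in> suplat_hom (tensor L M) K"
    and eq: "\<And>l m. l \<in> carrier L \<Longrightarrow> m \<in> carrier M \<Longrightarrow>
      g (pure_tensor L M l m) = h (pure_tensor L M l m)"
    and T: "T \<in> carrier (tensor L M)"
  shows "g T = h T"
proof -
  note * = suplat_bihom_comp_hom[OF pure_tensor_bihom[OF L M] h]
  note ** = tensor_universal(3)[OF L M suplat_homD(2)[OF h] *, rotated 2, OF T]
  show ?thesis using **[OF g eq] **[OF h refl] by simp
qed

text \<open>An element of the tensor product is a set of pairs, and it is the join of the corresponding pure
  tensors.\<close>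

lemma tensor_hom_eq_sup:
  assumes L: "complete_lattice L" and M: "complete_lattice M"
    and g: "g \<in> suplat_hom (tensor L M) K" and T: "T \<in> carrier (tensor L M)"
  shows "g T = \<Squnion>\<^bsub>K\<^esub>((\<lambda>(l, m). g (pure_tensor L M l m)) ` T)"
  using tensor_universal(3)[OF L M suplat_homD(2)[OF g]
      suplat_bihom_comp_hom[OF pure_tensor_bihom[OF L M] g] g refl T]
  by (simp add: tensor_lift_def)

text \<open>This is how maps in three or four variables are extended to tensor products one step at a time:
  the extension in two of the variables is still join-preserving in each of the others.\<close>

lemma tensor_lift_hom_parameter:
  assumes N: "complete_lattice N" and K: "complete_lattice K" and T: "T \<in> carrier (tensor L M)"
    and f: "\<And>l m. l \<in> carrier L \<Longrightarrow> m \<in> carrier M \<Longrightarrow> (\<lambda>n. f n l m) \<in> suplat_hom N K"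
  shows "(\<lambda>n. tensor_lift K (f n) T) \<in> suplat_hom N K"
proof -
  have "(\<lambda>n. (case i of (l, m) \<Rightarrow> f n l m)) \<in> suplat_hom N K" if "i \<in> T" for i
    using that T f by (cases i) (auto simp: bi_ideal_def)
  then show ?thesis unfolding tensor_lift_def by (rule suplat_hom_pointwise_sup[OF N K])
qed

context
  fixes L :: "('a, 'x) gorder_scheme" and M :: "('b, 'y) gorder_scheme"
    and L' :: "('c, 'z) gorder_scheme" and M' :: "('d, 'w) gorder_scheme" and f g
  assumes f: "f \<in> suplat_hom L L'" and g: "g \<in> suplat_hom M M'"
begin

lemma tensor_map_hom: "tensor_map L' M' f g \<in> suplat_hom (tensor L M) (tensor L' M')"
  and tensor_map_pure: "l \<in> carrier L \<Longrightarrow> m \<in> carrier M \<Longrightarrow>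
    tensor_map L' M' f g (pure_tensor L M l m) = pure_tensor L' M' (f l) (g m)"
proof -
  note L = suplat_homD(1,2)[OF f] and M = suplat_homD(1,2)[OF g]
  note * = suplat_bihom_comp_homs[OF f g pure_tensor_bihom[OF L(2) M(2)]]
  note univ = tensor_universal[OF L(1) M(1) complete_lattice_tensor[OF L(2) M(2)] *]
  show "tensor_map L' M' f g \<in> suplat_hom (tensor L M) (tensor L' M')"
    unfolding tensor_map_def by (rule univ)
  show "l \<in> carrier L \<Longrightarrow> m \<in> carrier M \<Longrightarrow>
      tensor_map L' M' f g (pure_tensor L M l m) = pure_tensor L' M' (f l) (g m)"
    unfolding tensor_map_def by (rule univ)
qed

lemma hom_tensor_map_eq_sup:
  assumes G: "G \<in> suplat_hom (tensor L' M') K" and T: "T \<in> carrier (tensor L M)"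
  shows "G (tensor_map L' M' f g T) = \<Squnion>\<^bsub>K\<^esub>((\<lambda>(l, m). G (pure_tensor L' M' (f l) (g m))) ` T)"
proof -
  have "G (tensor_map L' M' f g T) =
      \<Squnion>\<^bsub>K\<^esub>((\<lambda>(l, m). G (tensor_map L' M' f g (pure_tensor L M l m))) ` T)"
    using tensor_hom_eq_sup[OF suplat_homD(1)[OF f] suplat_homD(1)[OF g]
        suplat_hom_comp[OF tensor_map_hom G] T] .
  also have "(\<lambda>(l, m). G (tensor_map L' M' f g (pure_tensor L M l m))) ` T =
      (\<lambda>(l, m). G (pure_tensor L' M' (f l) (g m))) ` T"
    using T by (intro image_cong) (auto simp: bi_ideal_def tensor_map_pure)
  finally show ?thesis .
qed

end

text \<open>The tensor product turns a pair of commuting squares into a commuting square. All compatibilities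
  of an induced map with \<open>\<pi> \<otimes> \<pi>\<close> are instances, with identities as some of the sides.\<close>

lemma tensor_map_square:
  assumes f: "f \<in> suplat_hom L L1" "f1 \<in> suplat_hom L1 L3"
      "f' \<in> suplat_hom L L2" "f2 \<in> suplat_hom L2 L3"
      "\<And>l. l \<in> carrier L \<Longrightarrow> f1 (f l) = f2 (f' l)"
    and g: "g \<in> suplat_hom M M1" "g1 \<in> suplat_hom M1 M3"
      "g' \<in> suplat_hom M M2" "g2 \<in> suplat_hom M2 M3"
      "\<And>m. m \<in> carrier M \<Longrightarrow> g1 (g m) = g2 (g' m)"
    and T: "T \<in> carrier (tensor L M)"
  shows "tensor_map L3 M3 f1 g1 (tensor_map L1 M1 f g T) =
    tensor_map L3 M3 f2 g2 (tensor_map L2 M2 f' g' T)"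
proof (rule tensor_hom_ext[OF suplat_homD(1)[OF f(1)] suplat_homD(1)[OF g(1)] _ _ _ T])
  show "(\<lambda>T. tensor_map L3 M3 f1 g1 (tensor_map L1 M1 f g T)) \<in>
      suplat_hom (tensor L M) (tensor L3 M3)"
    by (rule suplat_hom_comp[OF tensor_map_hom[OF f(1) g(1)] tensor_map_hom[OF f(2) g(2)]])
  show "(\<lambda>T. tensor_map L3 M3 f2 g2 (tensor_map L2 M2 f' g' T)) \<in>
      suplat_hom (tensor L M) (tensor L3 M3)"
    by (rule suplat_hom_comp[OF tensor_map_hom[OF f(3) g(3)] tensor_map_hom[OF f(4) g(4)]])
  fix l m assume l: "l \<in> carrier L" and m: "m \<in> carrier M"
  show "tensor_map L3 M3 f1 g1 (tensor_map L1 M1 f g (pure_tensor L M l m)) =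
      tensor_map L3 M3 f2 g2 (tensor_map L2 M2 f' g' (pure_tensor L M l m))"
    using l m suplat_homD(3)[OF f(1) l] suplat_homD(3)[OF f(3) l]
      suplat_homD(3)[OF g(1) m] suplat_homD(3)[OF g(3) m] f(5)[OF l] g(5)[OF m]
    by (simp add: tensor_map_pure[OF f(1) g(1)] tensor_map_pure[OF f(3) g(3)]
        tensor_map_pure[OF f(2) g(2)] tensor_map_pure[OF f(4) g(4)])
qed


section \<open>Naturality of the monoidal structure\<close>

context
  fixes L :: "('a, 'x) gorder_scheme" and M :: "('b, 'y) gorder_scheme"
    and N :: "('c, 'z) gorder_scheme"
  assumes L: "complete_lattice L" and M: "complete_lattice M" and N: "complete_lattice N"
begin

lemma tensor_assoc_hom:
    "tensor_assoc L M N \<in> suplat_hom (tensor (tensor L M) N) (tensor L (tensor M N))" (is ?hom)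
  and tensor_assoc_pure:
    "\<lbrakk>l \<in> carrier L; m \<in> carrier M; n \<in> carrier N\<rbrakk> \<Longrightarrow>
      tensor_assoc L M N (pure_tensor (tensor L M) N (pure_tensor L M l m) n) =
      pure_tensor L (tensor M N) l (pure_tensor M N m n)"
proof -
  let ?K = "tensor L (tensor M N)"
  let ?h = "\<lambda>l m n. pure_tensor L (tensor M N) l (pure_tensor M N m n)"
  note LM = complete_lattice_tensor[OF L M] and MN = complete_lattice_tensor[OF M N]
  note K = complete_lattice_tensor[OF L MN]
  note pb = pure_tensor_bihom[OF L MN] and pb' = pure_tensor_bihom[OF M N]
  have h_bihom: "(\<lambda>l m. ?h l m n) \<in> suplat_bihom L M ?K" if "n \<in> carrier N" for n
    by (rule suplat_bihom_comp_homs[OF suplat_hom_ident[OF L] suplat_bihomD(2)[OF pb' that] pb])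
  have h_hom: "(\<lambda>n. ?h l m n) \<in> suplat_hom N ?K" if "l \<in> carrier L" "m \<in> carrier M" for l m
    by (rule suplat_hom_comp[OF suplat_bihomD(1)[OF pb' that(2)] suplat_bihomD(1)[OF pb that(1)]])
  have "(\<lambda>t n. tensor_lift ?K (\<lambda>l m. ?h l m n) t) \<in> suplat_bihom (tensor L M) N ?K"
    using tensor_lift_hom_parameter[OF N K _ h_hom] tensor_universal(1)[OF L M K h_bihom]
    by (intro suplat_bihomI)
  note univ = tensor_universal(1,2)[OF LM N K this, folded tensor_assoc_def]
  show ?hom by (rule univ)
  show "tensor_assoc L M N (pure_tensor (tensor L M) N (pure_tensor L M l m) n) = ?h l m n"
    if "l \<in> carrier L" "m \<in> carrier M" "n \<in> carrier N" for l m n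
    using univ(2)[OF pure_tensor_closed[OF L M that(1,2)] that(3)]
      tensor_universal(2)[OF L M K h_bihom[OF that(3)] that(1,2)] by simp
qed

lemma tensor3_hom_ext:
  assumes g: "g \<in> suplat_hom (tensor (tensor L M) N) K" and h: "h \<in> suplat_hom (tensor (tensor L M) N) K"
    and eq: "\<And>l m n. \<lbrakk>l \<in> carrier L; m \<in> carrier M; n \<in> carrier N\<rbrakk> \<Longrightarrow>
      g (pure_tensor (tensor L M) N (pure_tensor L M l m) n) =
      h (pure_tensor (tensor L M) N (pure_tensor L M l m) n)"
    and T: "T \<in> carrier (tensor (tensor L M) N)"
  shows "g T = h T"
proof (rule tensor_hom_ext[OF complete_lattice_tensor[OF L M] N g h _ T])
  fix t n assume t: "t \<in> carrier (tensor L M)" and n: "n \<in> carrier N"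
  note slice = suplat_bihomD(2)[OF pure_tensor_bihom[OF complete_lattice_tensor[OF L M] N] n]
  show "g (pure_tensor (tensor L M) N t n) = h (pure_tensor (tensor L M) N t n)"
    using tensor_hom_ext[OF L M suplat_hom_comp[OF slice g] suplat_hom_comp[OF slice h] eq[OF _ _ n] t] .
qed

end

text \<open>Both sides send \<open>(l \<otimes> m) \<otimes> n\<close> to \<open>f l \<otimes> (g m \<otimes> h n)\<close>.\<close>

lemma tensor_assoc_natural:
  assumes f: "f \<in> suplat_hom L L'" and g: "g \<in> suplat_hom M M'" and h: "h \<in> suplat_hom N N'"
    and T: "T \<in> carrier (tensor (tensor L M) N)"
  shows "tensor_assoc L' M' N' (tensor_map (tensor L' M') N' (tensor_map L' M' f g) h T) =
    tensor_map L' (tensor M' N') f (tensor_map M' N' g h) (tensor_assoc L M N T)"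
proof -
  note L = suplat_homD(1,2)[OF f] and M = suplat_homD(1,2)[OF g] and N = suplat_homD(1,2)[OF h]
  note fg = tensor_map_hom[OF f g] and gh = tensor_map_hom[OF g h]
  note fg_h = tensor_map_hom[OF fg h] and f_gh = tensor_map_hom[OF f gh]
  note a = tensor_assoc_hom[OF L(1) M(1) N(1)] and a' = tensor_assoc_hom[OF L(2) M(2) N(2)]
  show ?thesis
  proof (rule tensor3_hom_ext[OF L(1) M(1) N(1) suplat_hom_comp[OF fg_h a'] suplat_hom_comp[OF a f_gh] _ T])
    fix l m n assume l: "l \<in> carrier L" and m: "m \<in> carrier M" and n: "n \<in> carrier N"
    note lm = pure_tensor_closed[OF L(1) M(1) l m] and mn = pure_tensor_closed[OF M(1) N(1) m n]
    have "tensor_assoc L' M' N' (tensor_map (tensor L' M') N' (tensor_map L' M' f g) h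
          (pure_tensor (tensor L M) N (pure_tensor L M l m) n)) =
        pure_tensor L' (tensor M' N') (f l) (pure_tensor M' N' (g m) (h n))"
      unfolding tensor_map_pure[OF fg h lm n] tensor_map_pure[OF f g l m]
      by (rule tensor_assoc_pure[OF L(2) M(2) N(2)]) (rule suplat_homD(3)[OF f l]
          suplat_homD(3)[OF g m] suplat_homD(3)[OF h n])+
    also have "\<dots> = tensor_map L' (tensor M' N') f (tensor_map M' N' g h)
        (pure_tensor L (tensor M N) l (pure_tensor M N m n))"
      unfolding tensor_map_pure[OF f gh l mn] tensor_map_pure[OF g h m n] ..
    finally show "tensor_assoc L' M' N' (tensor_map (tensor L' M') N' (tensor_map L' M' f g) h
          (pure_tensor (tensor L M) N (pure_tensor L M l m) n)) =
        tensor_map L' (tensor M' N') f (tensor_map M' N' g h)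
          (tensor_assoc L M N (pure_tensor (tensor L M) N (pure_tensor L M l m) n))"
      unfolding tensor_assoc_pure[OF L(1) M(1) N(1) l m n] .
  qed
qed

lemma complete_lattice_P1: "complete_lattice P1"
  unfolding P1_def by (rule powerset_is_complete_lattice)

lemma P1_hom_sup_empty_iff:
  assumes r: "r \<in> suplat_hom L P1" and A: "A \<subseteq> carrier L"
  shows "r (\<Squnion>\<^bsub>L\<^esub>A) = {} \<longleftrightarrow> (\<forall>a\<in>A. r a = {})"
proof -
  interpret P1: complete_lattice P1 by (rule complete_lattice_P1)
  have im: "r ` A \<subseteq> carrier P1" using suplat_homD(3)[OF r] A by blast
  show ?thesis unfolding suplat_homD(4)[OF r A]
    using P1.sup_le_iff[OF im, of "{}"] by (simp add: P1_def)
qed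

lemma P1_hom_eq_one_iff:
  "r \<in> suplat_hom L P1 \<Longrightarrow> x \<in> carrier L \<Longrightarrow> r x = {()} \<longleftrightarrow> r x \<noteq> {}"
  using suplat_homD(3)[of r L P1 x] by (auto simp: P1_def)

lemma scalar_hom:
  assumes L: "complete_lattice L" and l: "l \<in> carrier L"
  shows "(\<lambda>p. if p = {} then \<bottom>\<^bsub>L\<^esub> else l) \<in> suplat_hom P1 L"
proof (rule suplat_homI)
  interpret L: complete_lattice L by fact
  show "(if p = {} then \<bottom>\<^bsub>L\<^esub> else l) \<in> carrier L" for p using l by simp
  fix A assume A: "A \<subseteq> carrier P1"
  let ?f = "\<lambda>p. if p = {} then \<bottom>\<^bsub>L\<^esub> else l"
  have im: "?f ` A \<subseteq> carrier L" using l by auto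
  have eq: "\<Squnion>\<^bsub>P1\<^esub>A = {} \<longleftrightarrow> (\<forall>p\<in>A. p = {})"
    using P1_hom_sup_empty_iff[OF suplat_hom_ident[OF complete_lattice_P1] A] .
  show "?f (\<Squnion>\<^bsub>P1\<^esub>A) = \<Squnion>\<^bsub>L\<^esub>(?f ` A)"
  proof (rule L.eq_by_upper)
    fix k assume k: "k \<in> carrier L"
    show "(?f (\<Squnion>\<^bsub>P1\<^esub>A) \<sqsubseteq>\<^bsub>L\<^esub> k) = (\<Squnion>\<^bsub>L\<^esub>(?f ` A) \<sqsubseteq>\<^bsub>L\<^esub> k)"
      unfolding L.sup_le_iff[OF im k] eq using k by auto
  qed (use l L.sup_closed[OF im] in auto)
qed (fact L complete_lattice_P1)+

lemma bottom_hom: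
  assumes L: "complete_lattice L" and M: "complete_lattice M"
  shows "(\<lambda>_. \<bottom>\<^bsub>M\<^esub>) \<in> suplat_hom L M"
proof -
  interpret M: complete_lattice M by fact
  have "\<Squnion>\<^bsub>M\<^esub>{} = \<bottom>\<^bsub>M\<^esub>" using M.weak_sup_empty by (simp add: M.eq_is_equal)
  then show ?thesis using suplat_hom_pointwise_sup[OF L M, of "{}"] by simp
qed

context
  fixes L :: "('a, 'x) gorder_scheme"
  assumes L: "complete_lattice L"
begin

lemma left_scalar_bihom: "(\<lambda>p l. if p = {} then \<bottom>\<^bsub>L\<^esub> else l) \<in> suplat_bihom P1 L L"
proof (rule suplat_bihomI)
  show "(\<lambda>l. if p = {} then \<bottom>\<^bsub>L\<^esub> else l) \<in> suplat_hom L L" for p :: "unit set"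
    using bottom_hom[OF L L] suplat_hom_ident[OF L] by (cases "p = {}") auto
qed (rule scalar_hom[OF L])

lemma right_scalar_bihom: "(\<lambda>l p. if p = {} then \<bottom>\<^bsub>L\<^esub> else l) \<in> suplat_bihom L P1 L"
proof (rule suplat_bihomI)
  show "(\<lambda>l. if p = {} then \<bottom>\<^bsub>L\<^esub> else l) \<in> suplat_hom L L" for p :: "unit set"
    using bottom_hom[OF L L] suplat_hom_ident[OF L] by (cases "p = {}") auto
qed (rule scalar_hom[OF L])

lemmas left_unitor_hom = tensor_universal(1)[OF complete_lattice_P1 L L left_scalar_bihom,
    folded left_unitor_def]
  and left_unitor_pure = tensor_universal(2)[OF complete_lattice_P1 L L left_scalar_bihom,
    folded left_unitor_def]
  and right_unitor_hom = tensor_universal(1)[OF L complete_lattice_P1 L right_scalar_bihom,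
    folded right_unitor_def]
  and right_unitor_pure = tensor_universal(2)[OF L complete_lattice_P1 L right_scalar_bihom,
    folded right_unitor_def]

end

lemma left_unitor_natural:
  assumes f: "f \<in> suplat_hom L L'" and T: "T \<in> carrier (tensor P1 L)"
  shows "left_unitor L' (tensor_map P1 L' id f T) = f (left_unitor L T)"
proof -
  note L = suplat_homD(1,2)[OF f] and i = suplat_hom_id[OF complete_lattice_P1]
  show ?thesis
  proof (rule tensor_hom_ext[OF complete_lattice_P1 L(1) _ _ _ T])
    show "(\<lambda>T. left_unitor L' (tensor_map P1 L' id f T)) \<in> suplat_hom (tensor P1 L) L'"
      by (rule suplat_hom_comp[OF tensor_map_hom[OF i f] left_unitor_hom[OF L(2)]])
    show "(\<lambda>T. f (left_unitor L T)) \<in> suplat_hom (tensor P1 L) L'"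
      by (rule suplat_hom_comp[OF left_unitor_hom[OF L(1)] f])
    show "left_unitor L' (tensor_map P1 L' id f (pure_tensor P1 L p l)) =
        f (left_unitor L (pure_tensor P1 L p l))" if "p \<in> carrier P1" "l \<in> carrier L" for p l
      using that suplat_homD(3)[OF f] suplat_hom_bottom[OF f]
      by (simp add: tensor_map_pure[OF i f] left_unitor_pure[OF L(1)] left_unitor_pure[OF L(2)])
  qed
qed

lemma right_unitor_natural:
  assumes f: "f \<in> suplat_hom L L'" and T: "T \<in> carrier (tensor L P1)"
  shows "right_unitor L' (tensor_map L' P1 f id T) = f (right_unitor L T)"
proof -
  note L = suplat_homD(1,2)[OF f] and i = suplat_hom_id[OF complete_lattice_P1]
  show ?thesis
  proof (rule tensor_hom_ext[OF L(1) complete_lattice_P1 _ _ _ T])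
    show "(\<lambda>T. right_unitor L' (tensor_map L' P1 f id T)) \<in> suplat_hom (tensor L P1) L'"
      by (rule suplat_hom_comp[OF tensor_map_hom[OF f i] right_unitor_hom[OF L(2)]])
    show "(\<lambda>T. f (right_unitor L T)) \<in> suplat_hom (tensor L P1) L'"
      by (rule suplat_hom_comp[OF right_unitor_hom[OF L(1)] f])
    show "right_unitor L' (tensor_map L' P1 f id (pure_tensor L P1 l p)) =
        f (right_unitor L (pure_tensor L P1 l p))" if "l \<in> carrier L" "p \<in> carrier P1" for p l
      using that suplat_homD(3)[OF f] suplat_hom_bottom[OF f]
      by (simp add: tensor_map_pure[OF f i] right_unitor_pure[OF L(1)] right_unitor_pure[OF L(2)])
  qed
qed


section \<open>The componentwise product on the tensor square\<close>

lemma alg_prod_bihom: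
  assumes "complete_lattice H" "mult \<in> suplat_hom (tensor H H) H"
  shows "alg_prod H mult \<in> suplat_bihom H H H"
  using suplat_bihom_comp_hom[OF pure_tensor_bihom[OF assms(1,1)] assms(2)]
  by (simp add: alg_prod_def[abs_def])

context
  fixes H :: "('a, 'x) gorder_scheme" and mult
  assumes H: "complete_lattice H" and mult: "mult \<in> suplat_hom (tensor H H) H"
begin

lemma tensor_alg_prod_right_bihom:
  assumes "a \<in> carrier H" "b \<in> carrier H"
  shows "(\<lambda>a' b'. pure_tensor H H (alg_prod H mult a a') (alg_prod H mult b b'))
    \<in> suplat_bihom H H (tensor H H)"
  using assms by (intro suplat_bihom_comp_homs[OF _ _ pure_tensor_bihom[OF H H]]
    suplat_bihomD(1)[OF alg_prod_bihom[OF H mult]])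

lemma tensor_alg_prod_left_bihom:
  assumes T: "T \<in> carrier (tensor H H)"
  shows "(\<lambda>a b. tensor_lift (tensor H H) (\<lambda>a' b'.
    pure_tensor H H (alg_prod H mult a a') (alg_prod H mult b b')) T)
    \<in> suplat_bihom H H (tensor H H)"
proof (rule suplat_bihomI; rule tensor_lift_hom_parameter[OF H complete_lattice_tensor[OF H H] T])
  note ab = suplat_bihom_comp_homs[OF _ _ pure_tensor_bihom[OF H H]]
  note mh = suplat_bihomD(2)[OF alg_prod_bihom[OF H mult]]
  fix a' b' c assume *: "a' \<in> carrier H" "b' \<in> carrier H" "c \<in> carrier H"
  note bihom = ab[OF mh[OF *(1)] mh[OF *(2)]]
  show "(\<lambda>b. pure_tensor H H (alg_prod H mult c a') (alg_prod H mult b b')) \<in> suplat_hom H (tensor H H)"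
    by (rule suplat_bihomD(1)[OF bihom *(3)])
  show "(\<lambda>a. pure_tensor H H (alg_prod H mult a a') (alg_prod H mult c b')) \<in> suplat_hom H (tensor H H)"
    by (rule suplat_bihomD(2)[OF bihom *(3)])
qed

lemma tensor_alg_prod_left_hom:
  assumes "t \<in> carrier (tensor H H)"
  shows "(\<lambda>s. tensor_alg_prod H mult s t) \<in> suplat_hom (tensor H H) (tensor H H)"
  unfolding tensor_alg_prod_def
  by (rule tensor_universal(1)[OF H H complete_lattice_tensor[OF H H] tensor_alg_prod_left_bihom[OF assms]])

lemma tensor_alg_prod_pure_left:
  assumes "a \<in> carrier H" "b \<in> carrier H" "t \<in> carrier (tensor H H)"
  shows "tensor_alg_prod H mult (pure_tensor H H a b) t = tensor_lift (tensor H H) (\<lambda>a' b'.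
    pure_tensor H H (alg_prod H mult a a') (alg_prod H mult b b')) t"
  unfolding tensor_alg_prod_def
  by (rule tensor_universal(2)[OF H H complete_lattice_tensor[OF H H]
        tensor_alg_prod_left_bihom[OF assms(3)] assms(1,2)])

lemma tensor_alg_prod_pure:
  assumes "a \<in> carrier H" "b \<in> carrier H" "a' \<in> carrier H" "b' \<in> carrier H"
  shows "tensor_alg_prod H mult (pure_tensor H H a b) (pure_tensor H H a' b') =
    pure_tensor H H (alg_prod H mult a a') (alg_prod H mult b b')"
  unfolding tensor_alg_prod_pure_left[OF assms(1,2) pure_tensor_closed[OF H H assms(3,4)]]
  by (rule tensor_universal(2)[OF H H complete_lattice_tensor[OF H H]
        tensor_alg_prod_right_bihom[OF assms(1,2)] assms(3,4)])

lemma tensor_alg_prod_pure_left_hom: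
  assumes "a \<in> carrier H" "b \<in> carrier H"
  shows "tensor_alg_prod H mult (pure_tensor H H a b) \<in> suplat_hom (tensor H H) (tensor H H)"
proof (rule suplat_hom_of_comp_surj[OF suplat_hom_ident[OF complete_lattice_tensor[OF H H]]])
  show "tensor_lift (tensor H H) (\<lambda>a' b'. pure_tensor H H (alg_prod H mult a a') (alg_prod H mult b b'))
      \<in> suplat_hom (tensor H H) (tensor H H)"
    by (rule tensor_universal(1)[OF H H complete_lattice_tensor[OF H H]
          tensor_alg_prod_right_bihom[OF assms]])
qed (simp, rule tensor_alg_prod_pure_left[OF assms])

end

text \<open>Both sides send a pair \<open>a \<otimes> b\<close>, \<open>a' \<otimes> b'\<close> to \<open>f (a.a') \<otimes> f (b.b')\<close>, and both preserve joins in
  \<open>s\<close>; they preserve joins in \<open>t\<close> for pure \<open>s\<close>, which is enough.\<close>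

lemma tensor_alg_prod_natural:
  assumes f: "f \<in> suplat_hom H Q"
    and mult: "mult \<in> suplat_hom (tensor H H) H" and mult': "mult' \<in> suplat_hom (tensor Q Q) Q"
    and f_mult: "\<And>a b. a \<in> carrier H \<Longrightarrow> b \<in> carrier H \<Longrightarrow>
      f (alg_prod H mult a b) = alg_prod Q mult' (f a) (f b)"
    and s: "s \<in> carrier (tensor H H)" and t: "t \<in> carrier (tensor H H)"
  shows "tensor_map Q Q f f (tensor_alg_prod H mult s t) =
    tensor_alg_prod Q mult' (tensor_map Q Q f f s) (tensor_map Q Q f f t)"
proof -
  note H = suplat_homD(1)[OF f] and Q = suplat_homD(2)[OF f]
  note ff = tensor_map_hom[OF f f] and ff_pure = tensor_map_pure[OF f f]
  note prod_closed = suplat_bihomD(3)[OF alg_prod_bihom[OF H mult]]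
  show ?thesis
  proof (rule tensor_hom_ext[OF H H _ _ _ s])
    show "(\<lambda>s. tensor_map Q Q f f (tensor_alg_prod H mult s t)) \<in> suplat_hom (tensor H H) (tensor Q Q)"
      by (rule suplat_hom_comp[OF tensor_alg_prod_left_hom[OF H mult t] ff])
    show "(\<lambda>s. tensor_alg_prod Q mult' (tensor_map Q Q f f s) (tensor_map Q Q f f t))
        \<in> suplat_hom (tensor H H) (tensor Q Q)"
      by (rule suplat_hom_comp[OF ff tensor_alg_prod_left_hom[OF Q mult' suplat_homD(3)[OF ff t]]])
    fix a b assume ab: "a \<in> carrier H" "b \<in> carrier H"
    note fab = suplat_homD(3)[OF f ab(1)] suplat_homD(3)[OF f ab(2)]
    show "tensor_map Q Q f f (tensor_alg_prod H mult (pure_tensor H H a b) t) =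
      tensor_alg_prod Q mult' (tensor_map Q Q f f (pure_tensor H H a b)) (tensor_map Q Q f f t)"
      unfolding ff_pure[OF ab]
    proof (rule tensor_hom_ext[OF H H _ _ _ t])
      show "(\<lambda>t. tensor_map Q Q f f (tensor_alg_prod H mult (pure_tensor H H a b) t))
          \<in> suplat_hom (tensor H H) (tensor Q Q)"
        by (rule suplat_hom_comp[OF tensor_alg_prod_pure_left_hom[OF H mult ab] ff])
      show "(\<lambda>t. tensor_alg_prod Q mult' (pure_tensor Q Q (f a) (f b)) (tensor_map Q Q f f t))
          \<in> suplat_hom (tensor H H) (tensor Q Q)"
        by (rule suplat_hom_comp[OF ff tensor_alg_prod_pure_left_hom[OF Q mult' fab]])
      fix a' b' assume ab': "a' \<in> carrier H" "b' \<in> carrier H"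
      note fab' = suplat_homD(3)[OF f ab'(1)] suplat_homD(3)[OF f ab'(2)]
      show "tensor_map Q Q f f (tensor_alg_prod H mult (pure_tensor H H a b) (pure_tensor H H a' b')) =
          tensor_alg_prod Q mult' (pure_tensor Q Q (f a) (f b)) (tensor_map Q Q f f (pure_tensor H H a' b'))"
        unfolding ff_pure[OF ab'] tensor_alg_prod_pure[OF H mult ab ab']
          tensor_alg_prod_pure[OF Q mult' fab fab']
        using ff_pure prod_closed f_mult ab ab' by simp
    qed
  qed
qed


section \<open>The kernel of the counit\<close>

context suplat_hopf
begin

text \<open>By the left counit law \<open>h\<close> is the join of all \<open>b\<close> with \<open>(a, b) \<le> \<Delta>(h)\<close> and
  \<open>\<epsilon>(a) \<noteq> \<emptyset>\<close>, and \<open>r\<close> vanishes on a join if and only if it vanishes on all joinands.\<close>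

lemma hom_empty_iff_comult:
  assumes r: "r \<in> suplat_hom H P1" and h: "h \<in> carrier H"
  shows "r h = {} \<longleftrightarrow> (\<forall>(a, b) \<in> comult h. counit a = {} \<or> r b = {})"
proof -
  note HH = complete_lattice_axioms
  note id_hom = suplat_hom_id[OF HH]
  have T: "comult h \<in> carrier (tensor H H)" using suplat_homD(3)[OF comult_hom h] .
  then have sub: "comult h \<subseteq> carrier H \<times> carrier H" by (simp add: bi_ideal_def)
  let ?F = "\<lambda>(a, b). left_unitor H (pure_tensor P1 H (counit a) (id b))"
  have F: "?F (a, b) = (if counit a = {} then \<bottom> else b)" if "(a, b) \<in> comult h" for a b
  proof -
    have a: "a \<in> carrier H" and b: "b \<in> carrier H" using that sub by auto
    show ?thesis using left_unitor_pure[OF HH suplat_homD(3)[OF counit_hom a] b] by simp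
  qed
  have im: "?F ` comult h \<subseteq> carrier H" using F sub by fastforce
  have "h = \<Squnion>(?F ` comult h)"
    using counit_left[OF h] hom_tensor_map_eq_sup[OF counit_hom id_hom left_unitor_hom[OF HH] T] by simp
  then have "r h = {} \<longleftrightarrow> (\<forall>x \<in> comult h. r (?F x) = {})"
    using P1_hom_sup_empty_iff[OF r im] by simp
  also have "\<dots> \<longleftrightarrow> (\<forall>(a, b) \<in> comult h. counit a = {} \<or> r b = {})"
  proof (rule ball_cong[OF HOL.refl])
    fix x assume x: "x \<in> comult h"
    obtain a b where ab: "x = (a, b)" by (cases x)
    show "r (?F x) = {} \<longleftrightarrow> (case x of (a, b) \<Rightarrow> counit a = {} \<or> r b = {})"
      using F[of a b] x suplat_hom_bottom[OF r] by (simp add: ab P1_bottom)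
  qed
  finally show ?thesis .
qed

lemma counit_prod_empty_iff:
  assumes "a \<in> carrier H" "b \<in> carrier H"
  shows "counit (alg_prod H mult a b) = {} \<longleftrightarrow> counit a = {} \<or> counit b = {}"
  using counit_mult[OF assms] P1_hom_eq_one_iff[OF counit_hom assms(1)]
    P1_hom_eq_one_iff[OF counit_hom assms(2)] P1_hom_eq_one_iff[OF counit_hom
      suplat_bihomD(3)[OF alg_prod_bihom[OF complete_lattice_axioms mult_hom] assms]] by blast

text \<open>Both sides are equivalent to the vanishing of \<open>\<epsilon>\<close> on \<open>m(id \<otimes> S)\<Delta>(h)\<close>: the right one by the
  antipode law, and the left one because this element is the join of the \<open>a.S(b)\<close> with
  \<open>(a, b) \<le> \<Delta>(h)\<close> and the convolution of \<open>\<epsilon>\<close> with \<open>\<epsilon>S\<close> is \<open>\<epsilon>S\<close>.\<close>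

lemma counit_antipode_empty_iff:
  assumes h: "h \<in> carrier H"
  shows "counit (antipode h) = {} \<longleftrightarrow> counit h = {}"
proof -
  have T: "comult h \<in> carrier (tensor H H)" using suplat_homD(3)[OF comult_hom h] .
  then have sub: "comult h \<subseteq> carrier H \<times> carrier H" by (simp add: bi_ideal_def)
  note S = suplat_homD(3)[OF antipode_hom]
  let ?F = "\<lambda>(a, b). alg_prod H mult a (antipode b)"
  have im: "?F ` comult h \<subseteq> carrier H"
    using sub by (auto intro!: S suplat_bihomD(3)[OF alg_prod_bihom[OF complete_lattice_axioms mult_hom]])
  have "mult (tensor_map H H id antipode (comult h)) = \<Squnion>(?F ` comult h)"
    using hom_tensor_map_eq_sup[OF suplat_hom_id[OF complete_lattice_axioms] antipode_hom mult_hom T]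
    by (simp add: alg_prod_def)
  then have "counit (if counit h = {()} then one else \<bottom>) = {} \<longleftrightarrow>
      (\<forall>x \<in> comult h. counit (?F x) = {})"
    using antipode_right[OF h] P1_hom_sup_empty_iff[OF counit_hom im] by simp
  moreover have "counit (if counit h = {()} then one else \<bottom>) = {} \<longleftrightarrow> counit h = {}"
    using counit_one suplat_hom_bottom[OF counit_hom] P1_hom_eq_one_iff[OF counit_hom h]
    by (auto simp: P1_bottom)
  moreover have "(\<forall>x \<in> comult h. counit (?F x) = {}) \<longleftrightarrow>
      (\<forall>(a, b) \<in> comult h. counit a = {} \<or> counit (antipode b) = {})"
  proof (rule ball_cong[OF HOL.refl])
    fix x assume x: "x \<in> comult h"
    obtain a b where ab: "x = (a, b)" by (cases x)
    then have "a \<in> carrier H" "antipode b \<in> carrier H" using x sub S by auto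
    then show "counit (?F x) = {} \<longleftrightarrow> (case x of (a, b) \<Rightarrow> counit a = {} \<or> counit (antipode b) = {})"
      by (simp add: ab counit_prod_empty_iff)
  qed
  moreover note hom_empty_iff_comult[OF suplat_hom_comp[OF antipode_hom counit_hom] h]
  ultimately show ?thesis by simp
qed

text \<open>For every pair \<open>(a, b) \<le> \<Delta>(h)\<close> the counit vanishes on \<open>a\<close> or on \<open>b\<close>, so that one of the factors
  of \<open>p a \<otimes> p b\<close> is the least element.\<close>

lemma tensor_map_comult_eq_bottom:
  assumes p: "p \<in> suplat_hom H Q" and p_bot: "\<And>h. h \<in> carrier H \<Longrightarrow> counit h = {} \<Longrightarrow> p h = \<bottom>\<^bsub>Q\<^esub>"
    and h: "h \<in> carrier H" "counit h = {}"
  shows "tensor_map Q Q p p (comult h) = \<bottom>\<^bsub>tensor Q Q\<^esub>"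
proof -
  note Q = suplat_homD(2)[OF p] and pc = suplat_homD(3)[OF p]
  interpret QQ: complete_lattice "tensor Q Q" by (rule complete_lattice_tensor[OF Q Q])
  interpret Q: complete_lattice Q by (rule Q)
  note bh = pure_tensor_bihom[OF Q Q]
  have T: "comult h \<in> carrier (tensor H H)" using suplat_homD(3)[OF comult_hom h(1)] .
  then have sub: "comult h \<subseteq> carrier H \<times> carrier H" by (simp add: bi_ideal_def)
  let ?F = "\<lambda>(a, b). pure_tensor Q Q (p a) (p b)"
  have F: "?F x = \<bottom>\<^bsub>tensor Q Q\<^esub>" if x: "x \<in> comult h" for x
  proof -
    obtain a b where ab: "x = (a, b)" "a \<in> carrier H" "b \<in> carrier H" using x sub by auto
    have "counit a = {} \<or> counit b = {}"
      using hom_empty_iff_comult[OF counit_hom h(1)] h(2) x ab by auto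
    then have "p a = \<bottom>\<^bsub>Q\<^esub> \<or> p b = \<bottom>\<^bsub>Q\<^esub>" using p_bot ab by blast
    then show ?thesis
      using suplat_hom_bottom[OF suplat_bihomD(1)[OF bh pc]]
        suplat_hom_bottom[OF suplat_bihomD(2)[OF bh pc]] ab by auto
  qed
  have "tensor_map Q Q p p (comult h) = \<Squnion>\<^bsub>tensor Q Q\<^esub>(?F ` comult h)"
    using hom_tensor_map_eq_sup[OF p p suplat_hom_ident[OF QQ.complete_lattice_axioms] T] .
  also have "\<dots> = \<Squnion>\<^bsub>tensor Q Q\<^esub>((\<lambda>_. \<bottom>\<^bsub>tensor Q Q\<^esub>) ` comult h)"
    using F by (metis (no_types, lifting) image_cong)
  also have "\<dots> = \<bottom>\<^bsub>tensor Q Q\<^esub>"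
  proof -
    have "\<Squnion>\<^bsub>tensor Q Q\<^esub>((\<lambda>_. \<bottom>\<^bsub>tensor Q Q\<^esub>) ` comult h) \<sqsubseteq>\<^bsub>tensor Q Q\<^esub> \<bottom>\<^bsub>tensor Q Q\<^esub>"
      by (rule QQ.sup_least) (auto simp del: tensor_simps)
    then show ?thesis
      by (intro QQ.le_antisym QQ.bottom_lower QQ.sup_closed) (auto simp del: tensor_simps)
  qed
  finally show ?thesis .
qed

end


section \<open>The quotient Hopf algebra\<close>

lemma descend_bihom:
  assumes p: "p \<in> suplat_hom B Q" and surj: "p ` carrier B = carrier Q"
    and f: "f \<in> suplat_bihom B B K"
    and l: "\<And>a a' b. \<lbrakk>a \<in> carrier B; a' \<in> carrier B; b \<in> carrier B; p a = p a'\<rbrakk> \<Longrightarrow> f a b = f a' b"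
    and r: "\<And>a b b'. \<lbrakk>a \<in> carrier B; b \<in> carrier B; b' \<in> carrier B; p b = p b'\<rbrakk> \<Longrightarrow> f a b = f a b'"
  shows "\<exists>u \<in> suplat_bihom Q Q K. \<forall>a \<in> carrier B. \<forall>b \<in> carrier B. u (p a) (p b) = f a b"
proof -
  define s where "s = inv_into (carrier B) p"
  have s: "s (p a) \<in> carrier B" "p (s (p a)) = p a" if "a \<in> carrier B" for a
    using that unfolding s_def by (auto intro: inv_into_into f_inv_into_f)
  define u where "u x y = f (s x) (s y)" for x y
  have u: "u (p a) (p b) = f a b" if "a \<in> carrier B" "b \<in> carrier B" for a b
    using that s l r unfolding u_def by metis
  have "u \<in> suplat_bihom Q Q K"
  proof (rule suplat_bihomI)
    fix x assume "x \<in> carrier Q"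
    then obtain a where a: "a \<in> carrier B" "x = p a" using surj by auto
    show "u x \<in> suplat_hom Q K"
      by (rule suplat_hom_of_comp_surj[OF p surj suplat_bihomD(1)[OF f a(1)]]) (simp add: a u)
    show "(\<lambda>l. u l x) \<in> suplat_hom Q K"
      by (rule suplat_hom_of_comp_surj[OF p surj suplat_bihomD(2)[OF f a(1)]]) (simp add: a u)
  qed
  then show ?thesis using u by blast
qed

text \<open>In the proof \<open>Sinv\<close> is the inverse of the antipode, and a prime marks the induced map on \<open>Q\<close>.\<close>

theorem lemma3p5:
  fixes H :: "'h gorder"
    and mult :: "('h \<times> 'h) set \<Rightarrow> 'h" and one :: "'h" and comult :: "'h \<Rightarrow> ('h \<times> 'h) set"
    and counit :: "'h \<Rightarrow> unit set" and antipode :: "'h \<Rightarrow> 'h"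
    and Q :: "'q gorder" and \<pi> :: "'h \<Rightarrow> 'q"
  assumes "suplat_hopf H mult one comult counit antipode"
    and "suplat_coequalizer TYPE('h set) (counit_kernel H counit) H (\<lambda>_. \<bottom>\<^bsub>H\<^esub>) (\<lambda>h. h) Q \<pi>"
  shows "\<exists>mult' one' comult' counit' antipode'.
           suplat_hopf Q mult' one' comult' counit' antipode' \<and>
           suplat_hopf_morphism H mult one comult counit antipode
             Q mult' one' comult' counit' antipode' \<pi>"
proof -
  interpret H: suplat_hopf H mult one comult counit antipode by fact
  have p: "\<pi> \<in> suplat_hom H Q" and eq: "\<And>a. a \<in> carrier (counit_kernel H counit) \<Longrightarrow> \<pi> \<bottom>\<^bsub>H\<^esub> = \<pi> a"
    using assms(2) unfolding suplat_coequalizer_def by blast+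
  note H = H.complete_lattice_axioms and Q = suplat_homD(2)[OF p]
  note HH = complete_lattice_tensor[OF H H] and QQ = complete_lattice_tensor[OF Q Q]
  note pc = suplat_homD(3)[OF p] and surj = suplat_coequalizer_surj[OF assms(2)]
  note pp = tensor_map_hom[OF p p] and pp_pure = tensor_map_pure[OF p p]
  note idH = suplat_hom_id[OF H] and idQ = suplat_hom_id[OF Q]
  note prod = alg_prod_bihom[OF H H.mult_hom]
  note comult_closed = suplat_homD(3)[OF H.comult_hom]
  have p_bot: "\<pi> h = \<bottom>\<^bsub>Q\<^esub>" if "h \<in> carrier H" "counit h = {}" for h
    using eq[of h] that suplat_hom_bottom[OF p] by (simp add: counit_kernel_def)
  have factor: "\<exists>u \<in> suplat_hom Q K. \<forall>h \<in> carrier H. u (\<pi> h) = r h"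
    if r: "r \<in> suplat_hom H K" and r_bot: "\<And>h. h \<in> carrier H \<Longrightarrow> counit h = {} \<Longrightarrow> r h = \<bottom>\<^bsub>K\<^esub>"
    for K :: "'k gorder" and r
    using suplat_coequalizer_factor[OF assms(2) r] r_bot suplat_hom_bottom[OF r]
    by (simp add: counit_kernel_def)

  obtain counit' where e: "counit' \<in> suplat_hom Q P1" "\<And>h. h \<in> carrier H \<Longrightarrow> counit' (\<pi> h) = counit h"
    using factor[OF H.counit_hom] by (auto simp: P1_bottom)
  have "tensor_map Q Q \<pi> \<pi> (comult h) = \<bottom>\<^bsub>tensor Q Q\<^esub>" if "h \<in> carrier H" "counit h = {}" for h
    by (rule H.tensor_map_comult_eq_bottom[OF p p_bot that])
  from factor[OF suplat_hom_comp[OF H.comult_hom pp] this]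
  obtain comult' where d: "comult' \<in> suplat_hom Q (tensor Q Q)"
      "\<And>h. h \<in> carrier H \<Longrightarrow> comult' (\<pi> h) = tensor_map Q Q \<pi> \<pi> (comult h)"
    by auto
  have "\<pi> (antipode h) = \<bottom>\<^bsub>Q\<^esub>" if "h \<in> carrier H" "counit h = {}" for h
    using p_bot suplat_homD(3)[OF H.antipode_hom] H.counit_antipode_empty_iff that by simp
  from factor[OF suplat_hom_comp[OF H.antipode_hom p] this]
  obtain antipode' where S: "antipode' \<in> suplat_hom Q Q"
      "\<And>h. h \<in> carrier H \<Longrightarrow> antipode' (\<pi> h) = \<pi> (antipode h)"
    by auto

  \<comment> \<open>The equivalence \<open>\<epsilon>(S(h)) = \<emptyset> \<longleftrightarrow> \<epsilon>(h) = \<emptyset>\<close>, taken at \<open>S\<^sup>-\<^sup>1(h)\<close>, lets the inverse descend as well.\<close>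
  obtain Sinv where Sinv: "Sinv \<in> suplat_hom H H"
      "\<And>h. h \<in> carrier H \<Longrightarrow> Sinv (antipode h) = h" "\<And>h. h \<in> carrier H \<Longrightarrow> antipode (Sinv h) = h"
    using H.antipode_invertible by blast
  have "\<pi> (Sinv h) = \<bottom>\<^bsub>Q\<^esub>" if "h \<in> carrier H" "counit h = {}" for h
    using H.counit_antipode_empty_iff[OF suplat_homD(3)[OF Sinv(1) that(1)]] Sinv(3) that
      p_bot suplat_homD(3)[OF Sinv(1)] by simp
  from factor[OF suplat_hom_comp[OF Sinv(1) p] this]
  obtain Sinv' where Sinv': "Sinv' \<in> suplat_hom Q Q"
      "\<And>h. h \<in> carrier H \<Longrightarrow> Sinv' (\<pi> h) = \<pi> (Sinv h)"
    by auto

  note p_prod = suplat_bihom_comp_hom[OF prod p]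
  \<comment> \<open>The multiplication descends in one variable at a time, the other one being held fixed in \<open>H\<close>.\<close>
  have kill: "\<pi> (alg_prod H mult a b) = \<bottom>\<^bsub>Q\<^esub>"
    if "a \<in> carrier H" "b \<in> carrier H" "counit a = {} \<or> counit b = {}" for a b
    using H.counit_prod_empty_iff[OF that(1,2)] that(3) by (intro p_bot suplat_bihomD(3)[OF prod] that) simp
  have left: "\<pi> (alg_prod H mult a b) = \<pi> (alg_prod H mult a' b)"
    if "a \<in> carrier H" "a' \<in> carrier H" "b \<in> carrier H" "\<pi> a = \<pi> a'" for a a' b
  proof -
    have "\<pi> (alg_prod H mult h b) = \<bottom>\<^bsub>Q\<^esub>" if "h \<in> carrier H" "counit h = {}" for h
      using kill that \<open>b \<in> carrier H\<close> by simp
    from factor[OF suplat_bihomD(2)[OF p_prod that(3)] this]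
    obtain u where "\<forall>h \<in> carrier H. u (\<pi> h) = \<pi> (alg_prod H mult h b)" by auto
    then show ?thesis using that by metis
  qed
  have right: "\<pi> (alg_prod H mult a b) = \<pi> (alg_prod H mult a b')"
    if "a \<in> carrier H" "b \<in> carrier H" "b' \<in> carrier H" "\<pi> b = \<pi> b'" for a b b'
  proof -
    have "\<pi> (alg_prod H mult a h) = \<bottom>\<^bsub>Q\<^esub>" if "h \<in> carrier H" "counit h = {}" for h
      using kill that \<open>a \<in> carrier H\<close> by simp
    from factor[OF suplat_bihomD(1)[OF p_prod that(1)] this]
    obtain u where "\<forall>h \<in> carrier H. u (\<pi> h) = \<pi> (alg_prod H mult a h)" by auto
    then show ?thesis using that by metis
  qed
  have "\<exists>u \<in> suplat_bihom Q Q Q. \<forall>a \<in> carrier H. \<forall>b \<in> carrier H.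
      u (\<pi> a) (\<pi> b) = \<pi> (alg_prod H mult a b)"
    by (rule descend_bihom[OF p surj p_prod]) (fact left right)+
  then obtain prod' where prod': "prod' \<in> suplat_bihom Q Q Q"
      "\<And>a b. a \<in> carrier H \<Longrightarrow> b \<in> carrier H \<Longrightarrow> prod' (\<pi> a) (\<pi> b) = \<pi> (alg_prod H mult a b)"
    by auto
  define mult' where "mult' = tensor_lift Q prod'"
  note univ = tensor_universal(1,2)[OF Q Q Q prod'(1), folded mult'_def]
  note mult' = univ(1)
  have prod_p: "alg_prod Q mult' (\<pi> a) (\<pi> b) = \<pi> (alg_prod H mult a b)"
    if "a \<in> carrier H" "b \<in> carrier H" for a b
    unfolding alg_prod_def[of Q] using univ(2) pc prod'(2) that by simp
  have p_mult: "mult' (tensor_map Q Q \<pi> \<pi> t) = \<pi> (mult t)" if t: "t \<in> carrier (tensor H H)" for t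
  proof (rule tensor_hom_ext[OF H H suplat_hom_comp[OF pp mult'] suplat_hom_comp[OF H.mult_hom p] _ t])
    fix a b assume ab: "a \<in> carrier H" "b \<in> carrier H"
    show "mult' (tensor_map Q Q \<pi> \<pi> (pure_tensor H H a b)) = \<pi> (mult (pure_tensor H H a b))"
      using prod_p[OF ab] by (simp add: pp_pure[OF ab] alg_prod_def)
  qed
  have surjE: "\<exists>h \<in> carrier H. q = \<pi> h" if "q \<in> carrier Q" for q using surj that by auto
  note prod_closed = suplat_bihomD(3)[OF prod]

  have "suplat_hopf Q mult' (\<pi> one) comult' counit' antipode'"
  proof (intro suplat_hopf.intro suplat_hopf_axioms.intro)
    show "complete_lattice Q" by (rule Q)
    show "mult' \<in> suplat_hom (tensor Q Q) Q" by (rule mult')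
    show "\<pi> one \<in> carrier Q" by (rule pc[OF H.one_closed])
    show "comult' \<in> suplat_hom Q (tensor Q Q)" by (rule d)
    show "counit' \<in> suplat_hom Q P1" by (rule e)
    show "antipode' \<in> suplat_hom Q Q" by (rule S)
    show "\<exists>S' \<in> suplat_hom Q Q. \<forall>q \<in> carrier Q. S' (antipode' q) = q \<and> antipode' (S' q) = q"
    proof (intro bexI[OF _ Sinv'(1)] ballI)
      fix q assume "q \<in> carrier Q"
      then obtain h where "h \<in> carrier H" "q = \<pi> h" using surjE by blast
      then show "Sinv' (antipode' q) = q \<and> antipode' (Sinv' q) = q"
        using S(2) Sinv Sinv'(2) suplat_homD(3)[OF H.antipode_hom] suplat_homD(3)[OF Sinv(1)] by simp
    qed
    show "alg_prod Q mult' (alg_prod Q mult' x y) z = alg_prod Q mult' x (alg_prod Q mult' y z)"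
      if "x \<in> carrier Q" "y \<in> carrier Q" "z \<in> carrier Q" for x y z
    proof -
      from surjE[OF that(1)] surjE[OF that(2)] surjE[OF that(3)]
      obtain a b c where "a \<in> carrier H" "x = \<pi> a" "b \<in> carrier H" "y = \<pi> b" "c \<in> carrier H" "z = \<pi> c"
        by blast
      then show ?thesis using prod_p prod_closed H.mult_assoc by simp
    qed
    show "comult' (\<pi> one) = pure_tensor Q Q (\<pi> one) (\<pi> one)"
      using d(2) H.one_closed H.comult_one pp_pure by simp
    show "counit' (\<pi> one) = {()}" using e(2) H.one_closed H.counit_one by simp
    fix q assume "q \<in> carrier Q"
    then obtain h where h: "h \<in> carrier H" "q = \<pi> h" using surjE by blast
    note T = comult_closed[OF h(1)] and dq = d(2)[OF h(1), folded h(2)]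
    show "alg_prod Q mult' (\<pi> one) q = q" "alg_prod Q mult' q (\<pi> one) = q"
      using h prod_p H.one_closed H.mult_one_left H.mult_one_right by simp_all
    show "tensor_assoc Q Q Q (tensor_map (tensor Q Q) Q comult' id (comult' q)) =
        tensor_map Q (tensor Q Q) id comult' (comult' q)"
    proof -
      have "tensor_map (tensor Q Q) Q comult' id (comult' q) =
          tensor_map (tensor Q Q) Q (tensor_map Q Q \<pi> \<pi>) \<pi> (tensor_map (tensor H H) H comult id (comult h))"
        unfolding dq using d(2)
        by (intro tensor_map_square[OF p d(1) H.comult_hom pp _ p idQ idH p _ T]) simp_all
      then have "tensor_assoc Q Q Q (tensor_map (tensor Q Q) Q comult' id (comult' q)) =
          tensor_map Q (tensor Q Q) \<pi> (tensor_map Q Q \<pi> \<pi>)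
            (tensor_assoc H H H (tensor_map (tensor H H) H comult id (comult h)))"
        using tensor_assoc_natural[OF p p p suplat_homD(3)[OF tensor_map_hom[OF H.comult_hom idH] T]]
        by simp
      also have "\<dots> = tensor_map Q (tensor Q Q) \<pi> (tensor_map Q Q \<pi> \<pi>)
          (tensor_map H (tensor H H) id comult (comult h))"
        unfolding H.comult_coassoc[OF h(1)] ..
      also have "\<dots> = tensor_map Q (tensor Q Q) id comult' (comult' q)"
        unfolding dq using d(2)
        by (intro tensor_map_square[OF idH p p idQ _ H.comult_hom pp p d(1) _ T]) simp_all
      finally show ?thesis .
    qed
    note idP = suplat_hom_id[OF complete_lattice_P1]
    show "left_unitor Q (tensor_map P1 Q counit' id (comult' q)) = q"
    proof -
      have "tensor_map P1 Q counit' id (comult' q) =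
          tensor_map P1 Q id \<pi> (tensor_map P1 H counit id (comult h))"
        unfolding dq using e(2)
        by (intro tensor_map_square[OF p e(1) H.counit_hom idP _ p idQ idH p _ T]) simp_all
      then show ?thesis
        using left_unitor_natural[OF p suplat_homD(3)[OF tensor_map_hom[OF H.counit_hom idH] T]]
          H.counit_left[OF h(1)] h(2) by simp
    qed
    show "right_unitor Q (tensor_map Q P1 id counit' (comult' q)) = q"
    proof -
      have "tensor_map Q P1 id counit' (comult' q) =
          tensor_map Q P1 \<pi> id (tensor_map H P1 id counit (comult h))"
        unfolding dq using e(2)
        by (intro tensor_map_square[OF p idQ idH p _ p e(1) H.counit_hom idP _ T]) simp_all
      then show ?thesis
        using right_unitor_natural[OF p suplat_homD(3)[OF tensor_map_hom[OF idH H.counit_hom] T]]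
          H.counit_right[OF h(1)] h(2) by simp
    qed
    \<comment> \<open>The right-hand sides of both antipode laws.\<close>
    have unit: "\<pi> (if counit h = {()} then one else \<bottom>\<^bsub>H\<^esub>) = (if counit' q = {()} then \<pi> one else \<bottom>\<^bsub>Q\<^esub>)"
      using e(2)[OF h(1)] h(2) suplat_hom_bottom[OF p] by simp
    show "mult' (tensor_map Q Q id antipode' (comult' q)) = (if counit' q = {()} then \<pi> one else \<bottom>\<^bsub>Q\<^esub>)"
    proof -
      have "tensor_map Q Q id antipode' (comult' q) =
          tensor_map Q Q \<pi> \<pi> (tensor_map H H id antipode (comult h))"
        unfolding dq using S(2)
        by (intro tensor_map_square[OF p idQ idH p _ p S(1) H.antipode_hom p _ T]) simp_all
      then show ?thesis
        using p_mult[OF suplat_homD(3)[OF tensor_map_hom[OF idH H.antipode_hom] T]]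
          H.antipode_right[OF h(1)] unit by simp
    qed
    show "mult' (tensor_map Q Q antipode' id (comult' q)) = (if counit' q = {()} then \<pi> one else \<bottom>\<^bsub>Q\<^esub>)"
    proof -
      have "tensor_map Q Q antipode' id (comult' q) =
          tensor_map Q Q \<pi> \<pi> (tensor_map H H antipode id (comult h))"
        unfolding dq using S(2)
        by (intro tensor_map_square[OF p S(1) H.antipode_hom p _ p idQ idH p _ T]) simp_all
      then show ?thesis
        using p_mult[OF suplat_homD(3)[OF tensor_map_hom[OF H.antipode_hom idH] T]]
          H.antipode_left[OF h(1)] unit by simp
    qed
    fix q' assume "q' \<in> carrier Q"
    then obtain h' where h': "h' \<in> carrier H" "q' = \<pi> h'" using surjE by blast
    show "counit' (alg_prod Q mult' q q') = {()} \<longleftrightarrow> counit' q = {()} \<and> counit' q' = {()}"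
      using h h' prod_p e(2) prod_closed H.counit_mult by simp
    show "comult' (alg_prod Q mult' q q') = tensor_alg_prod Q mult' (comult' q) (comult' q')"
    proof -
      have "tensor_map Q Q \<pi> \<pi> (tensor_alg_prod H mult (comult h) (comult h')) =
          tensor_alg_prod Q mult' (comult' q) (comult' q')"
        unfolding h'(2) dq d(2)[OF h'(1)]
        by (rule tensor_alg_prod_natural[OF p H.mult_hom mult' _ T comult_closed[OF h'(1)]]) (simp add: prod_p)
      then show ?thesis
        using h h' prod_p d(2) prod_closed H.comult_mult by simp
    qed
  qed
  moreover have "suplat_hopf_morphism H mult one comult counit antipode
      Q mult' (\<pi> one) comult' counit' antipode' \<pi>"
    unfolding suplat_hopf_morphism_def using p p_mult d(2) e(2) S(2) by simp
  ultimately show ?thesis by blast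
qed

end
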